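(* Let $(W,S)$ be a Coxeter system of rank $n\in\mathbb{N}$ with set of reflections $T$, and let $x\in W$ with $\ell_T(x)=n-1$. The element $x$ is a proper parabolic quasi-Coxeter element if and only if there exists a quasi-Coxeter element $w\in W$ with $x\leq_T w$ and $P(x)\neq W$. In this case, the parabolic closure $P(x)$ of $x$ has rank $n-1$.
   Context: For a Coxeter system $(W,S)$, $T=\{wsw^{-1}\mid w\in W,\ s\in S\}$ is its set of reflections and its rank is $|S|$. The reflection length $\ell_T(w)$ is the smallest $m$ such that $w$ is a product of $m$ elements of $T$; a factorization $w=t_1\cdots t_m$ with $t_i\in T$ and $m=\ell_T(w)$ is called a reduced reflection factorization. The absolute order $\leq_T$ on $W$ is defined by $u\leq_T v$ if and only if $\ell_T(u)+\ell_T(u^{-1}v)=\ell_T(v)$. A parabolic subgroup of $W$ is a subgroup $wW_Iw^{-1}$ with $w\in W$, $I\subseteq S$, $W_I=\langle I\rangle$; it is a Coxeter group with simple reflections $wIw^{-1}$ and rank $|I|$. The parabolic closure $P(x)$ of $x\in W$ is the intersection of all parabolic subgroups containing $x$ (which is itself a parabolic subgroup). An element $w\in W$ is a quasi-Coxeter element of the rank $n$ group $W$ if it admits a reduced reflection factorization with $n$ factors which generate $W$. An element is a proper parabolic quasi-Coxeter element if it is a quasi-Coxeter element of some proper parabolic subgroup of $W$ (a proper parabolic subgroup $wW_Iw^{-1}$ being regarded as a Coxeter group with set of simple reflections $wIw^{-1}$ and rank $|I|$). *)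

theory Defs
  imports "HOL-Algebra.Multiplicative_Group" "HOL-Algebra.Generated_Groups"
begin

definition word_prod :: "('a, 'b) monoid_scheme \<Rightarrow> 'a list \<Rightarrow> 'a" where
  "word_prod W ws = foldr (\<otimes>\<^bsub>W\<^esub>) ws \<one>\<^bsub>W\<^esub>"

text \<open>
  The congruence on words over \<open>S\<close> generated by the Coxeter relations
  \<open>(s t)\<^sup>m = 1\<close>, for \<open>s, t \<in> S\<close> with \<open>m\<close> the order of \<open>s t\<close> in \<open>W\<close>. Here
  \<open>group.ord\<close> is \<open>0\<close> for elements of infinite order; such pairs give no relation.
  For \<open>s = t\<close> of order two the relation reads \<open>s s = 1\<close>, so every letter is its own inverse
  modulo the congruence, and the quotient of the free monoid on \<open>S\<close> is the group
  \<open>\<langle>S | (s t)\<^sup>m\<rangle>\<close>.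
\<close>

inductive coxeter_word_eq :: "('a, 'b) monoid_scheme \<Rightarrow> 'a set \<Rightarrow> 'a list \<Rightarrow> 'a list \<Rightarrow> bool"
  for W and S where
  refl: "u \<in> lists S \<Longrightarrow> coxeter_word_eq W S u u"
| sym: "coxeter_word_eq W S u v \<Longrightarrow> coxeter_word_eq W S v u"
| trans: "coxeter_word_eq W S u v \<Longrightarrow> coxeter_word_eq W S v w \<Longrightarrow> coxeter_word_eq W S u w"
| relation: "u \<in> lists S \<Longrightarrow> v \<in> lists S \<Longrightarrow> s \<in> S \<Longrightarrow> t \<in> S \<Longrightarrow>
    m = group.ord W (s \<otimes>\<^bsub>W\<^esub> t) \<Longrightarrow> 0 < m \<Longrightarrow>
    coxeter_word_eq W S (u @ concat (replicate m [s, t]) @ v) (u @ v)"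

locale coxeter_system = group W for W (structure) +
  fixes S :: "'a set"
  assumes simple_closed: "S \<subseteq> carrier W"
    and simple_ord: "s \<in> S \<Longrightarrow> ord s = 2"
    and simple_generate: "generate W S = carrier W"
    and presentation: "u \<in> lists S \<Longrightarrow> v \<in> lists S \<Longrightarrow> word_prod W u = word_prod W v \<Longrightarrow>
      coxeter_word_eq W S u v"

definition conj_set :: "('a, 'b) monoid_scheme \<Rightarrow> 'a \<Rightarrow> 'a set \<Rightarrow> 'a set" where
  "conj_set W g A = (\<lambda>a. g \<otimes>\<^bsub>W\<^esub> a \<otimes>\<^bsub>W\<^esub> inv\<^bsub>W\<^esub> g) ` A"

definition reflections :: "('a, 'b) monoid_scheme \<Rightarrow> 'a set \<Rightarrow> 'a set" where
  "reflections W S = (\<Union>w\<in>carrier W. conj_set W w S)"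

definition reflection_length :: "('a, 'b) monoid_scheme \<Rightarrow> 'a set \<Rightarrow> 'a \<Rightarrow> nat" where
  "reflection_length W S w =
    (LEAST m. \<exists>ts \<in> lists (reflections W S). length ts = m \<and> word_prod W ts = w)"

definition reduced_reflection_factorization ::
  "('a, 'b) monoid_scheme \<Rightarrow> 'a set \<Rightarrow> 'a \<Rightarrow> 'a list \<Rightarrow> bool" where
  "reduced_reflection_factorization W S w ts \<longleftrightarrow>
    ts \<in> lists (reflections W S) \<and> word_prod W ts = w \<and> length ts = reflection_length W S w"

definition absolute_le :: "('a, 'b) monoid_scheme \<Rightarrow> 'a set \<Rightarrow> 'a \<Rightarrow> 'a \<Rightarrow> bool" where
  "absolute_le W S u v \<longleftrightarrow> u \<in> carrier W \<and> v \<in> carrier W \<and>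
    reflection_length W S u + reflection_length W S (inv\<^bsub>W\<^esub> u \<otimes>\<^bsub>W\<^esub> v) = reflection_length W S v"

definition quasi_coxeter :: "('a, 'b) monoid_scheme \<Rightarrow> 'a set \<Rightarrow> 'a \<Rightarrow> bool" where
  "quasi_coxeter W S w \<longleftrightarrow> w \<in> carrier W \<and>
    (\<exists>ts. reduced_reflection_factorization W S w ts \<and> length ts = card S \<and>
      generate W (set ts) = carrier W)"

definition parabolic :: "('a, 'b) monoid_scheme \<Rightarrow> 'a \<Rightarrow> 'a set \<Rightarrow> 'a set" where
  "parabolic W g I = conj_set W g (generate W I)"

definition parabolic_subgroup :: "('a, 'b) monoid_scheme \<Rightarrow> 'a set \<Rightarrow> 'a set \<Rightarrow> bool" where
  "parabolic_subgroup W S P \<longleftrightarrow> (\<exists>g \<in> carrier W. \<exists>I \<subseteq> S. P = parabolic W g I)"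

text \<open>
  The rank of a parabolic subgroup is the common cardinality of all \<open>I\<close> with
  \<open>P = g W\<^sub>I g\<^sup>-\<^sup>1\<close>; it is only meaningful when \<open>P\<close> is a parabolic subgroup.
\<close>

definition parabolic_rank :: "('a, 'b) monoid_scheme \<Rightarrow> 'a set \<Rightarrow> 'a set \<Rightarrow> nat" where
  "parabolic_rank W S P =
    (THE k. \<exists>g \<in> carrier W. \<exists>I \<subseteq> S. P = parabolic W g I \<and> card I = k)"

definition parabolic_closure :: "('a, 'b) monoid_scheme \<Rightarrow> 'a set \<Rightarrow> 'a \<Rightarrow> 'a set" where
  "parabolic_closure W S x = \<Inter>{P. parabolic_subgroup W S P \<and> x \<in> P}"

text \<open>
  The parabolic subgroup \<open>P = g W\<^sub>I g\<^sup>-\<^sup>1\<close> is regarded as a Coxeter group with simple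
  reflections \<open>g I g\<^sup>-\<^sup>1\<close>: reflections and reflection length are those of this
  Coxeter group, not those of \<open>W\<close>.
\<close>

definition proper_parabolic_quasi_coxeter ::
  "('a, 'b) monoid_scheme \<Rightarrow> 'a set \<Rightarrow> 'a \<Rightarrow> bool" where
  "proper_parabolic_quasi_coxeter W S x \<longleftrightarrow>
    (\<exists>g \<in> carrier W. \<exists>I \<subseteq> S. parabolic W g I \<noteq> carrier W \<and>
      quasi_coxeter (W\<lparr>carrier := parabolic W g I\<rparr>) (conj_set W g I) x)"

end

theory Submission
  imports Defs
begin

text \<open>
  The proof works with lengths and inversions only. Write \<open>\<ell>\<close> for the length in
  simple reflections and \<open>N(w)\<close> for the set of reflections \<open>t\<close> with \<open>\<ell>(t w) < \<ell>(w)\<close>.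

  The main tool is a normal form for reflection factorizations. A factorization
  \<open>t\<^sub>1 \<cdots> t\<^sub>m\<close> traces the path of its partial products, starting at \<open>1\<close>. At a local maximum of
  \<open>\<ell>\<close> with different neighbouring factors \<open>a\<close> and \<open>b\<close>, the pair can be replaced by another pair
  of reflections with the same product that generates the same dihedral group, so that the peak
  becomes lower (\<open>peak_descent\<close>). This changes neither the product nor the generated subgroup,
  so after finitely many steps
  either two equal factors are adjacent or \<open>\<ell>\<close> increases along the whole path
  (\<open>ascending_or_repetition\<close>). If the path increases and its end lies in a standard parabolic
  subgroup \<open>W\<^sub>I\<close>, then, going back from the end, every factor lies in \<open>W\<^sub>I\<close>, because
  \<open>N(w) \<subseteq> W\<^sub>I\<close> for \<open>w \<in> W\<^sub>I\<close>. Two equal adjacent factors cannot occur in a reduced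
  factorization, so all factors of a reduced factorization of an element of a parabolic subgroup lie
  in that subgroup (\<open>reduced_factorization_parabolic\<close>).

  Suppose that \<open>x\<close> is a quasi-Coxeter element of a proper parabolic subgroup \<open>P = g W\<^sub>I g\<^sup>-\<^sup>1\<close>.
  Comparing lengths forces \<open>I = S - {s}\<close>. The generating factorization of \<open>x\<close> in \<open>P\<close> is reduced
  in \<open>W\<close>, so every parabolic subgroup that contains \<open>x\<close> contains \<open>P\<close>; hence \<open>P(x) = P\<close> has rank
  \<open>n - 1\<close>. For \<open>r = g s g\<^sup>-\<^sup>1\<close> the element \<open>w = x r\<close> is a product of \<open>n\<close> reflections that generate
  \<open>W\<close>. It cannot be shorter: by parity its reflection length would be \<open>n - 2\<close>, and then \<open>r\<close> would be
  a factor of a reduced factorization of \<open>x\<close> and so lie in \<open>P\<close>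
  (\<open>reflection_length_extend\<close>).

  Conversely, let \<open>w = t\<^sub>1 \<cdots> t\<^sub>n\<close> be quasi-Coxeter and \<open>x = w t\<close> lie in a proper parabolic subgroup
  \<open>P\<close>, which may be taken of the form \<open>g W\<^sub>I g\<^sup>-\<^sup>1\<close> with \<open>I = S - {s}\<close>. The \<open>n + 1\<close> factors
  \<open>t\<^sub>1, \<dots>, t\<^sub>n, t\<close> of \<open>x\<close> generate \<open>W\<close>, so they cannot be rearranged into
  factors from \<open>P\<close>; two equal adjacent factors \<open>r, r\<close> must appear. Deleting them leaves a reduced
  factorization of \<open>x\<close>, whose factors generate some \<open>M \<subseteq> P\<close> such that \<open>M\<close> and \<open>r\<close> generate
  \<open>W\<close>. It remains to see that \<open>M = P\<close> (\<open>generate_eq_standard\<close>). This rests on Dyer's theory of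
  reflection subgroups. The canonical generators of \<open>M\<close> together with a shortest possible choice of
  \<open>r\<close> form a set in which any two elements are the canonical generators of the dihedral group that
  they generate. Such a set, if it generates \<open>W\<close>, contains \<open>S\<close>
  (\<open>simple_subset_pairwise_canonical\<close>). After conjugation by \<open>g\<^sup>-\<^sup>1\<close>, which turns \<open>P\<close> into \<open>W\<^sub>I\<close>,
  the elements of \<open>I\<close> must then be among the generators of \<open>M\<close>.
\<close>

context coxeter_system
begin

section \<open>Words, conjugation and reflections\<close>

abbreviation T where "T \<equiv> reflections W S"
abbreviation gen where "gen \<equiv> generate W"
abbreviation pr where "pr \<equiv> word_prod W"

definition conjugate :: "'a \<Rightarrow> 'a \<Rightarrow> 'a" where
  "conjugate g a = g \<otimes> a \<otimes> inv g"

lemma conj_set_eq_image: "conj_set W g A = conjugate g ` A"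
  by (simp add: conj_set_def conjugate_def)

lemma mult_inv_cancel [simp]:
  "x \<in> carrier W \<Longrightarrow> y \<in> carrier W \<Longrightarrow> x \<otimes> (inv x \<otimes> y) = y"
  "x \<in> carrier W \<Longrightarrow> y \<in> carrier W \<Longrightarrow> inv x \<otimes> (x \<otimes> y) = y"
  by (simp_all flip: m_assoc)

lemma conjugate_closed [simp]:
  "g \<in> carrier W \<Longrightarrow> a \<in> carrier W \<Longrightarrow> conjugate g a \<in> carrier W"
  by (simp add: conjugate_def)

lemma conjugate_one [simp]: "a \<in> carrier W \<Longrightarrow> conjugate \<one> a = a"
  by (simp add: conjugate_def)

lemma conjugate_of_one [simp]: "g \<in> carrier W \<Longrightarrow> conjugate g \<one> = \<one>"
  by (simp add: conjugate_def)

lemma conjugate_conjugate: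
  "g \<in> carrier W \<Longrightarrow> h \<in> carrier W \<Longrightarrow> a \<in> carrier W \<Longrightarrow>
    conjugate g (conjugate h a) = conjugate (g \<otimes> h) a"
  by (simp add: conjugate_def m_assoc inv_mult_group)

lemma conjugate_mult:
  "g \<in> carrier W \<Longrightarrow> a \<in> carrier W \<Longrightarrow> b \<in> carrier W \<Longrightarrow>
    conjugate g (a \<otimes> b) = conjugate g a \<otimes> conjugate g b"
  by (simp add: conjugate_def m_assoc)

lemma conjugate_inv_cancel [simp]:
  "g \<in> carrier W \<Longrightarrow> a \<in> carrier W \<Longrightarrow> conjugate g (conjugate (inv g) a) = a"
  "g \<in> carrier W \<Longrightarrow> a \<in> carrier W \<Longrightarrow> conjugate (inv g) (conjugate g a) = a"
  by (simp_all add: conjugate_conjugate)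

lemma conjugate_eq_iff:
  "g \<in> carrier W \<Longrightarrow> a \<in> carrier W \<Longrightarrow> b \<in> carrier W \<Longrightarrow>
    conjugate g a = b \<longleftrightarrow> a = conjugate (inv g) b"
  by auto

lemma inj_on_conjugate: "g \<in> carrier W \<Longrightarrow> inj_on (conjugate g) (carrier W)"
  by (metis conjugate_inv_cancel(2) inj_onI)

lemma word_prod_Nil [simp]: "pr [] = \<one>"
  by (simp add: word_prod_def)

lemma word_prod_Cons [simp]: "pr (a # ws) = a \<otimes> pr ws"
  by (simp add: word_prod_def)

lemma word_prod_closed [simp]: "set ws \<subseteq> carrier W \<Longrightarrow> pr ws \<in> carrier W"
  by (induction ws) auto

lemma word_prod_append:
  "set us \<subseteq> carrier W \<Longrightarrow> set vs \<subseteq> carrier W \<Longrightarrow> pr (us @ vs) = pr us \<otimes> pr vs"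
  by (induction us) (auto simp: m_assoc)

lemma word_prod_map_conjugate:
  "g \<in> carrier W \<Longrightarrow> set ws \<subseteq> carrier W \<Longrightarrow> pr (map (conjugate g) ws) = conjugate g (pr ws)"
  by (induction ws) (auto simp: conjugate_mult)

lemma reflectionsE:
  assumes "t \<in> T" obtains g s where "g \<in> carrier W" "s \<in> S" "t = conjugate g s"
  using assms by (auto simp: reflections_def conj_set_eq_image)

lemma reflectionsI: "g \<in> carrier W \<Longrightarrow> s \<in> S \<Longrightarrow> conjugate g s \<in> T"
  by (auto simp: reflections_def conj_set_eq_image)

lemma simple_carrier [simp]: "s \<in> S \<Longrightarrow> s \<in> carrier W"
  using simple_closed by auto

lemma simple_reflection [simp]: "s \<in> S \<Longrightarrow> s \<in> T"
  by (metis conjugate_one one_closed reflectionsI simple_carrier)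

lemma reflection_carrier [simp]: "t \<in> T \<Longrightarrow> t \<in> carrier W"
  by (auto elim!: reflectionsE)

lemma conjugate_reflection [simp]: "g \<in> carrier W \<Longrightarrow> t \<in> T \<Longrightarrow> conjugate g t \<in> T"
  by (metis conjugate_conjugate m_closed reflectionsE reflectionsI simple_carrier)

lemma simple_square: "s \<in> S \<Longrightarrow> s \<otimes> s = \<one>"
  using pow_ord_eq_1[of s] simple_ord[of s] by (simp add: numeral_2_eq_2)

lemma reflection_square [simp]: "t \<in> T \<Longrightarrow> t \<otimes> t = \<one>"
  by (erule reflectionsE) (simp add: simple_square flip: conjugate_mult)

lemma reflection_inv [simp]: "t \<in> T \<Longrightarrow> inv t = t"
  by (simp add: inv_equality)

lemma reflection_cancel [simp]: "t \<in> T \<Longrightarrow> y \<in> carrier W \<Longrightarrow> t \<otimes> (t \<otimes> y) = y"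
  by (simp flip: m_assoc)

lemma reflection_neq_one: assumes "t \<in> T" shows "t \<noteq> \<one>"
proof
  assume "t = \<one>"
  from assms obtain g s where gs: "g \<in> carrier W" "s \<in> S" "t = conjugate g s"
    by (rule reflectionsE)
  then have "s = \<one>"
    using \<open>t = \<one>\<close> by (metis conjugate_inv_cancel(2) conjugate_of_one inv_closed simple_carrier)
  then show False using simple_ord[OF gs(2)] by simp
qed

lemma lists_reflections_carrier: "ws \<in> lists T \<Longrightarrow> set ws \<subseteq> carrier W"
  by auto

lemma inv_word_prod: "ws \<in> lists T \<Longrightarrow> inv (pr ws) = pr (rev ws)"
proof (induction ws)
  case (Cons a ws)
  then have "pr ws \<in> carrier W" "set (rev ws) \<subseteq> carrier W" "a \<in> T"
    using lists_reflections_carrier by (auto intro!: word_prod_closed)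
  with Cons show ?case by (simp add: inv_mult_group word_prod_append)
qed simp

lemma word_prod_in_generate: "set ws \<subseteq> X \<Longrightarrow> X \<subseteq> carrier W \<Longrightarrow> pr ws \<in> gen X"
  by (induction ws) (auto intro: generate.intros)

lemma generate_word:
  assumes "X \<subseteq> T" "d \<in> gen X"
  obtains ws where "ws \<in> lists X" "pr ws = d"
proof -
  have "\<exists>ws\<in>lists X. pr ws = d"
    using assms(2)
  proof induction
    case one
    then show ?case by (intro bexI[of _ "[]"]) auto
  next
    case (incl h)
    then show ?case using assms(1) by (intro bexI[of _ "[h]"]) auto
  next
    case (inv h)
    then have "h \<in> T" using assms(1) by auto
    then show ?case using inv by (intro bexI[of _ "[h]"]) auto
  next
    case (eng h1 h2)
    then obtain us vs where "us \<in> lists X" "pr us = h1" "vs \<in> lists X" "pr vs = h2" by blast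
    moreover have "set us \<subseteq> carrier W" "set vs \<subseteq> carrier W"
      using calculation assms(1) by (auto dest!: subsetD intro!: reflection_carrier)
    ultimately show ?case
      by (intro bexI[of _ "us @ vs"]) (auto simp: word_prod_append)
  qed
  then show thesis using that by blast
qed

lemma simple_word:
  assumes "w \<in> carrier W" obtains ws where "ws \<in> lists S" "pr ws = w"
proof -
  have "S \<subseteq> T" by auto
  then show thesis using generate_word[of S w] assms simple_generate that by metis
qed

lemma generate_subgroup: "X \<subseteq> T \<Longrightarrow> subgroup (gen X) W"
  by (meson generate_is_subgroup reflection_carrier subset_iff)

lemma generate_subset_subgroup: "subgroup M W \<Longrightarrow> X \<subseteq> M \<Longrightarrow> gen X \<subseteq> M"
  using generate_subgroup_incl by blast

lemma generate_eqI:
  assumes "X \<subseteq> carrier W" "Y \<subseteq> carrier W" "X \<subseteq> gen Y" "Y \<subseteq> gen X"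
  shows "gen X = gen Y"
  using assms generate_is_subgroup generate_subset_subgroup by (meson equalityI)

lemma generate_carrier: "X \<subseteq> T \<Longrightarrow> gen X \<subseteq> carrier W"
  using generate_subgroup subgroup.subset by blast

lemma generate_conjugate:
  assumes "g \<in> carrier W" "X \<subseteq> carrier W"
  shows "gen (conjugate g ` X) = conjugate g ` gen X"
proof -
  have "group_hom W W (conjugate g)"
    using assms(1) by unfold_locales (auto simp: hom_def conjugate_mult)
  then show ?thesis using group_hom.generate_img assms(2) by metis
qed

lemma subgroup_conjugate:
  assumes "g \<in> carrier W" "subgroup M W" shows "subgroup (conjugate g ` M) W"
proof -
  have "group_hom W W (conjugate g)"
    using assms(1) by unfold_locales (auto simp: hom_def conjugate_mult)
  then show ?thesis using group_hom.subgroup_img_is_subgroup assms(2) by metis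
qed

section \<open>Inversions\<close>

text \<open>
  The letters of \<open>s\<^sub>1 s\<^sub>2 \<cdots> s\<^sub>m\<close> are conjugated by the preceding partial products:
  the entries are \<open>s\<^sub>1, s\<^sub>1 s\<^sub>2 s\<^sub>1, s\<^sub>1 s\<^sub>2 s\<^sub>3 s\<^sub>2 s\<^sub>1, \<dots>\<close>
\<close>

primrec palindromes :: "'a list \<Rightarrow> 'a list" where
  "palindromes [] = []"
| "palindromes (s # ws) = s # map (conjugate s) (palindromes ws)"

lemma palindromes_carrier: "set ws \<subseteq> carrier W \<Longrightarrow> set (palindromes ws) \<subseteq> carrier W"
  by (induction ws) auto

lemma palindromes_reflections: "ws \<in> lists T \<Longrightarrow> set (palindromes ws) \<subseteq> T"
  by (induction ws) auto

lemma length_palindromes [simp]: "length (palindromes ws) = length ws"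
  by (induction ws) auto

lemma palindromes_append:
  "set us \<subseteq> carrier W \<Longrightarrow> set vs \<subseteq> carrier W \<Longrightarrow>
    palindromes (us @ vs) = palindromes us @ map (conjugate (pr us)) (palindromes vs)"
proof (induction us)
  case Nil
  then have "set (palindromes vs) \<subseteq> carrier W" using palindromes_carrier by simp
  then show ?case by (auto intro!: map_idI[symmetric])
next
  case (Cons a us)
  then show ?case using palindromes_carrier[of vs]
    by (auto simp: conjugate_conjugate)
qed

lemma count_map_conjugate:
  "g \<in> carrier W \<Longrightarrow> set L \<subseteq> carrier W \<Longrightarrow> q \<in> carrier W \<Longrightarrow>
    count_list (map (conjugate g) L) q = count_list L (conjugate (inv g) q)"
  by (induction L) (auto simp: conjugate_eq_iff)

text \<open>
  For \<open>(s t)\<^sup>m = 1\<close> the \<open>2 m\<close> palindromes \<open>(s t)\<^sup>k s\<close> run twice through the same list of \<open>m\<close>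
  elements. Hence inserting a relator does not change the parity with which any reflection occurs.
\<close>

lemma palindromes_dihedral:
  assumes "s \<in> S" "t \<in> S"
  shows "palindromes (concat (replicate m [s, t])) = map (\<lambda>k. (s \<otimes> t) [^] k \<otimes> s) [0..<2 * m]"
proof (induction m)
  case (Suc m)
  let ?r = "s \<otimes> t"
  have sq: "inv s = s" "inv t = t" using assms by auto
  have shift: "conjugate ?r (?r [^] k \<otimes> s) = ?r [^] (Suc (Suc k)) \<otimes> s" for k
  proof -
    have "conjugate ?r (?r [^] k \<otimes> s) = (?r \<otimes> ?r [^] k) \<otimes> (s \<otimes> (t \<otimes> s))"
      using assms by (simp add: conjugate_def inv_mult_group m_assoc)
    also have "?r \<otimes> ?r [^] k = ?r [^] Suc k"
      using assms by (metis m_closed nat_pow_Suc2 simple_carrier)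
    finally show ?thesis using assms by (simp add: m_assoc)
  qed
  have "palindromes (concat (replicate (Suc m) [s, t]))
      = [s, conjugate s t] @ map (conjugate ?r) (map (\<lambda>k. ?r [^] k \<otimes> s) [0..<2 * m])"
    using Suc assms palindromes_append[of "[s, t]" "concat (replicate m [s, t])"]
    by (auto simp: set_replicate_conv_if)
  also have "map (conjugate ?r) (map (\<lambda>k. ?r [^] k \<otimes> s) [0..<2 * m])
      = map (\<lambda>k. ?r [^] k \<otimes> s) [2..<2 * Suc m]"
    by (rule nth_equalityI) (simp_all add: shift del: nat_pow_Suc upt_Suc)
  also have "[s, conjugate s t] = map (\<lambda>k. ?r [^] k \<otimes> s) [0..<2]"
    using assms sq by (simp add: numeral_2_eq_2 conjugate_def)
  also have "map (\<lambda>k. ?r [^] k \<otimes> s) [0..<2] @ map (\<lambda>k. ?r [^] k \<otimes> s) [2..<2 * Suc m]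
      = map (\<lambda>k. ?r [^] k \<otimes> s) [0..<2 * Suc m]"
    by (metis (no_types, lifting) le_add1 map_append mult_Suc_right upt_add_eq_append zero_le)
  finally show ?case .
qed simp

lemma word_prod_replicate:
  "s \<in> S \<Longrightarrow> t \<in> S \<Longrightarrow> pr (concat (replicate m [s, t])) = (s \<otimes> t) [^] m"
proof (induction m)
  case (Suc m)
  then have "s \<otimes> t \<in> carrier W" by simp
  then have "(s \<otimes> t) [^] Suc m = s \<otimes> t \<otimes> (s \<otimes> t) [^] m" by (rule nat_pow_Suc2)
  then show ?case using Suc by (simp add: m_assoc del: nat_pow_Suc)
qed simp

lemma even_count_relator:
  assumes "s \<in> S" "t \<in> S" "(s \<otimes> t) [^] m = \<one>"
  shows "even (count_list (palindromes (concat (replicate m [s, t]))) q)"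
proof -
  let ?f = "\<lambda>k. (s \<otimes> t) [^] k \<otimes> s"
  have "?f (k + m) = ?f k" for k
    using assms by (simp flip: nat_pow_mult)
  then have "map ?f (map (\<lambda>k. k + m) [0..<m]) = map ?f [0..<m]"
    by (simp add: comp_def)
  moreover have "[0..<2 * m] = [0..<m] @ map (\<lambda>k. k + m) [0..<m]"
    using upt_add_eq_append[of 0 m m] by (simp only: map_add_upt mult_2 add_0)
  ultimately have "map ?f [0..<2 * m] = map ?f [0..<m] @ map ?f [0..<m]"
    by (metis map_append)
  then show ?thesis
    using palindromes_dihedral[OF assms(1,2)] by simp
qed

text \<open>
  Both parities are invariants of the defining relations, so by the presentation they depend only on the value of the word.
\<close>

lemma coxeter_word_eq_invariant:
  assumes "coxeter_word_eq W S u v" "q \<in> carrier W"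
  shows "(odd (count_list (palindromes u) q) \<longleftrightarrow> odd (count_list (palindromes v) q)) \<and>
    (odd (length u) \<longleftrightarrow> odd (length v))"
  using assms(1)
proof induction
  case (relation u v s t m)
  let ?w = "concat (replicate m [s, t])"
  have one: "(s \<otimes> t) [^] m = \<one>" using relation pow_ord_eq_1 by simp
  have car: "set u \<subseteq> carrier W" "set v \<subseteq> carrier W" "set ?w \<subseteq> carrier W"
    using relation by (auto simp: set_replicate_conv_if)
  have "pr ?w = \<one>" using one relation by (simp add: word_prod_replicate)
  moreover have "map (conjugate \<one>) (palindromes v) = palindromes v"
    using palindromes_carrier[OF car(2)] by (auto intro!: map_idI)
  ultimately have "palindromes (?w @ v) = palindromes ?w @ palindromes v"
    using palindromes_append[OF car(3,2)] by metis
  then have "palindromes (u @ ?w @ v)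
      = palindromes u @ map (conjugate (pr u)) (palindromes ?w)
        @ map (conjugate (pr u)) (palindromes v)"
    using car palindromes_append[of u "?w @ v"] by simp
  moreover have "even (count_list (map (conjugate (pr u)) (palindromes ?w)) q)"
    using even_count_relator[OF relation(3,4) one] car assms(2) palindromes_carrier
    by (simp add: count_map_conjugate)
  moreover have "length ?w = 2 * m" by (induction m) auto
  ultimately show ?case using palindromes_append[OF car(1,2)] by simp
qed auto

text \<open>
  The usual inversion set \<open>N(w) = {t. \<ell>(t w) < \<ell>(w)}\<close>, encoded by parity of occurrences so that the
  cocycle identity and independence of the word are immediate from the presentation.
\<close>

definition inversions :: "'a \<Rightarrow> 'a set" where
  "inversions w = {q \<in> carrier W. \<exists>ws\<in>lists S. pr ws = w \<and> odd (count_list (palindromes ws) q)}"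

text \<open>
  The elements on which the sign character of \<open>W\<close> takes the value \<open>-1\<close>.
\<close>

definition odd_elt :: "'a \<Rightarrow> bool" where
  "odd_elt w \<longleftrightarrow> (\<exists>ws\<in>lists S. pr ws = w \<and> odd (length ws))"

lemma inversions_word:
  "ws \<in> lists S \<Longrightarrow> q \<in> carrier W \<Longrightarrow>
    q \<in> inversions (pr ws) \<longleftrightarrow> odd (count_list (palindromes ws) q)"
  unfolding inversions_def using coxeter_word_eq_invariant presentation by blast

lemma odd_elt_word: "ws \<in> lists S \<Longrightarrow> odd_elt (pr ws) \<longleftrightarrow> odd (length ws)"
  unfolding odd_elt_def using coxeter_word_eq_invariant[OF _ one_closed] presentation by blast

lemma lists_simple_carrier: "ws \<in> lists S \<Longrightarrow> set ws \<subseteq> carrier W"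
  by auto

lemma odd_elt_one [simp]: "\<not> odd_elt \<one>"
  using odd_elt_word[of "[]"] by simp

lemma odd_elt_mult:
  assumes "x \<in> carrier W" "y \<in> carrier W"
  shows "odd_elt (x \<otimes> y) \<longleftrightarrow> odd_elt x \<noteq> odd_elt y"
proof -
  obtain us vs where "us \<in> lists S" "pr us = x" "vs \<in> lists S" "pr vs = y"
    using simple_word assms by metis
  then show ?thesis
    using odd_elt_word[of us] odd_elt_word[of vs] odd_elt_word[of "us @ vs"]
    by (simp add: word_prod_append lists_simple_carrier)
qed

lemma odd_elt_inv: "x \<in> carrier W \<Longrightarrow> odd_elt (inv x) \<longleftrightarrow> odd_elt x"
  using odd_elt_mult[of x "inv x"] by simp

lemma odd_elt_reflection [simp]: assumes "t \<in> T" shows "odd_elt t"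
proof -
  obtain g s where gs: "g \<in> carrier W" "s \<in> S" "t = conjugate g s"
    using assms by (rule reflectionsE)
  moreover have "odd_elt s" using odd_elt_word[of "[s]"] gs by simp
  ultimately show ?thesis by (simp add: conjugate_def odd_elt_mult odd_elt_inv)
qed

lemma odd_elt_word_prod: "ws \<in> lists T \<Longrightarrow> odd_elt (pr ws) \<longleftrightarrow> odd (length ws)"
proof (induction ws)
  case (Cons a ws)
  then have "pr ws \<in> carrier W" by (auto intro!: word_prod_closed)
  with Cons show ?case by (simp add: odd_elt_mult)
qed simp

text \<open>
  The cocycle identity \<open>N(x y) = N(x) + x N(y) x\<^sup>-\<^sup>1\<close>, with \<open>+\<close> the symmetric difference. All later
  computations with inversions reduce to it.
\<close>

lemma inversions_mult:
  assumes "x \<in> carrier W" "y \<in> carrier W" "q \<in> carrier W"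
  shows "q \<in> inversions (x \<otimes> y) \<longleftrightarrow> (q \<in> inversions x) \<noteq> (conjugate (inv x) q \<in> inversions y)"
proof -
  obtain us vs where uv: "us \<in> lists S" "pr us = x" "vs \<in> lists S" "pr vs = y"
    using simple_word assms by metis
  have car: "set us \<subseteq> carrier W" "set vs \<subseteq> carrier W"
    using uv lists_simple_carrier by blast+
  have "q \<in> inversions (pr (us @ vs)) \<longleftrightarrow> odd (count_list (palindromes (us @ vs)) q)"
    using uv assms by (intro inversions_word) auto
  also have "\<dots> \<longleftrightarrow> odd (count_list (palindromes us) q)
      \<noteq> odd (count_list (palindromes vs) (conjugate (inv x) q))"
    using car uv assms palindromes_carrier[OF car(2)]
    by (auto simp: palindromes_append count_map_conjugate)
  finally show ?thesis
    using uv assms car inversions_word[of us q] inversions_word[of vs "conjugate (inv x) q"]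
    by (simp add: word_prod_append)
qed

lemma inversions_one [simp]: "inversions \<one> = {}"
  using inversions_word[of "[]"] by (auto simp: inversions_def)

lemma inversions_simple: assumes "s \<in> S" shows "inversions s = {s}"
proof (rule Set.set_eqI)
  fix q
  show "q \<in> inversions s \<longleftrightarrow> q \<in> {s}"
    using inversions_word[of "[s]" q] assms by (cases "q \<in> carrier W") (auto simp: inversions_def)
qed

lemma inversions_reflections: assumes "w \<in> carrier W" shows "inversions w \<subseteq> T"
proof
  fix q assume "q \<in> inversions w"
  then obtain ws where ws: "ws \<in> lists S" "odd (count_list (palindromes ws) q)"
    by (auto simp: inversions_def)
  then have "q \<in> set (palindromes ws)" by (metis count_notin even_zero)
  moreover have "ws \<in> lists T" using ws(1) by auto
  ultimately show "q \<in> T" using palindromes_reflections by blast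
qed

lemma inversions_inv:
  assumes "x \<in> carrier W" "q \<in> carrier W"
  shows "q \<in> inversions (inv x) \<longleftrightarrow> conjugate x q \<in> inversions x"
  using inversions_mult[of x "inv x" "conjugate x q"] assms by auto

text \<open>
  For \<open>t = g s g\<^sup>-\<^sup>1\<close> the contributions of \<open>g\<close> and of \<open>g\<^sup>-\<^sup>1\<close> to the parity cancel, and the middle
  letter contributes one.
\<close>

lemma reflection_in_inversions: assumes "t \<in> T" shows "t \<in> inversions t"
proof -
  obtain g s where gs: "g \<in> carrier W" "s \<in> S" "t = conjugate g s"
    using assms by (rule reflectionsE)
  have "t = g \<otimes> (s \<otimes> inv g)" using gs by (simp add: conjugate_def m_assoc)
  then have "t \<in> inversions t \<longleftrightarrow> (t \<in> inversions g) \<noteq> (s \<in> inversions (s \<otimes> inv g))"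
    using inversions_mult[of g "s \<otimes> inv g" t] gs
    by (metis conjugate_closed conjugate_inv_cancel(2) inv_closed m_closed simple_carrier)
  also have "s \<in> inversions (s \<otimes> inv g) \<longleftrightarrow> s \<notin> inversions (inv g)"
    using inversions_mult[of s "inv g" s] gs by (simp add: inversions_simple conjugate_def m_assoc)
  also have "s \<in> inversions (inv g) \<longleftrightarrow> t \<in> inversions g"
    using inversions_inv[of g s] gs by simp
  finally show ?thesis by blast
qed

lemma inversions_reflection_mult:
  assumes "t \<in> T" "w \<in> carrier W"
  shows "t \<in> inversions (t \<otimes> w) \<longleftrightarrow> t \<notin> inversions w"
  using inversions_mult[of t w t] assms reflection_in_inversions[of t]
  by (simp add: conjugate_def m_assoc)


section \<open>Word length\<close>

text \<open>
  For \<open>X = S\<close> this is the Coxeter length, for \<open>X\<close> the set of all reflections it is the reflection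
  length. Sets of canonical generators are the third case of interest.
\<close>

definition word_length :: "'a set \<Rightarrow> 'a \<Rightarrow> nat" where
  "word_length X d = (LEAST m. \<exists>ws \<in> lists X. length ws = m \<and> pr ws = d)"

lemma word_length_attained:
  assumes "X \<subseteq> T" "d \<in> gen X"
  obtains ws where "ws \<in> lists X" "pr ws = d" "length ws = word_length X d"
proof -
  have "\<exists>m. \<exists>ws \<in> lists X. length ws = m \<and> pr ws = d"
    using generate_word[OF assms] by blast
  from LeastI_ex[OF this] show thesis
    using that unfolding word_length_def by blast
qed

lemma word_length_le: "ws \<in> lists X \<Longrightarrow> pr ws = d \<Longrightarrow> word_length X d \<le> length ws"
  unfolding word_length_def by (rule Least_le) auto

lemma word_length_one [simp]: "word_length X \<one> = 0"
  using word_length_le[of "[]" X] by simp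

lemma word_length_eq_0:
  assumes "X \<subseteq> T" "d \<in> gen X" "word_length X d = 0" shows "d = \<one>"
  using word_length_attained[OF assms(1,2)] assms(3) by (metis length_0_conv word_prod_Nil)

lemma word_length_mult:
  assumes "X \<subseteq> T" "d \<in> gen X" "e \<in> gen X"
  shows "word_length X (d \<otimes> e) \<le> word_length X d + word_length X e"
proof -
  obtain us vs where uv: "us \<in> lists X" "pr us = d" "length us = word_length X d"
    "vs \<in> lists X" "pr vs = e" "length vs = word_length X e"
    using assms word_length_attained by metis
  then have "set us \<subseteq> carrier W" "set vs \<subseteq> carrier W" using assms(1) by auto
  then show ?thesis using uv word_length_le[of "us @ vs" X] by (simp add: word_prod_append)
qed

lemma word_length_generator: "t \<in> X \<Longrightarrow> X \<subseteq> T \<Longrightarrow> word_length X t = 1"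
proof -
  assume t: "t \<in> X" "X \<subseteq> T"
  then have "word_length X t \<le> 1" using word_length_le[of "[t]" X t] by auto
  moreover have "word_length X t \<noteq> 0"
    using word_length_eq_0[OF t(2), of t] t reflection_neq_one by (auto intro: generate.incl)
  ultimately show ?thesis by simp
qed

lemma word_length_inv:
  assumes "X \<subseteq> T" "d \<in> gen X" shows "word_length X (inv d) = word_length X d"
proof -
  have le: "word_length X (inv e) \<le> word_length X e" if e: "e \<in> gen X" for e
  proof -
    obtain ws where "ws \<in> lists X" "pr ws = e" "length ws = word_length X e"
      using word_length_attained[OF assms(1) e] .
    moreover have "ws \<in> lists T" "rev ws \<in> lists X" using calculation assms(1) by auto
    ultimately show ?thesis using inv_word_prod[of ws] word_length_le[of "rev ws" X "inv e"] by auto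
  qed
  have "d \<in> carrier W" using assms generate_carrier by blast
  then show ?thesis
    using le[of d] le[of "inv d"] assms generate_m_inv_closed[of X d] assms(1)
    by (metis antisym inv_inv reflection_carrier subsetI subset_iff)
qed

lemma word_length_antimono:
  assumes "X \<subseteq> Y" "Y \<subseteq> T" "d \<in> gen X" shows "word_length Y d \<le> word_length X d"
  using word_length_attained[of X d] assms word_length_le[of _ Y d]
  by (metis lists_mono order_trans subsetD)

text \<open>
  The exchange property: a palindrome of a word multiplies the word by cancelling one letter.
\<close>

lemma palindrome_deletion:
  assumes "ws \<in> lists T" "t \<in> set (palindromes ws)"
  obtains us a vs where "ws = us @ a # vs" "t \<otimes> pr ws = pr (us @ vs)" "t = conjugate (pr us) a"
  using assms
proof (induction ws arbitrary: t thesis rule: list.induct)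
  case (Cons b ws)
  then have bw: "b \<in> T" "ws \<in> lists T" "set ws \<subseteq> carrier W" by auto
  show ?case
  proof (cases "t = b")
    case True
    then show ?thesis using Cons.prems(1)[of "[]" b ws] bw by simp
  next
    case False
    then obtain q where q: "q \<in> set (palindromes ws)" "t = conjugate b q"
      using Cons.prems by auto
    obtain us a vs where usv: "ws = us @ a # vs" "q \<otimes> pr ws = pr (us @ vs)"
      "q = conjugate (pr us) a"
      using Cons.IH[OF _ bw(2) q(1)] by blast
    have "q \<in> carrier W" using q bw palindromes_carrier by auto
    moreover have "pr us \<in> carrier W" "a \<in> carrier W" using bw usv(1) by auto
    ultimately show ?thesis
      using Cons.prems(1)[of "b # us" a vs] usv q bw
      by (simp add: conjugate_def m_assoc inv_mult_group)
  qed
qed simp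

lemma word_length_palindrome:
  assumes "X \<subseteq> T" "ws \<in> lists X" "t \<in> set (palindromes ws)"
  shows "word_length X (t \<otimes> pr ws) < length ws"
proof -
  have "ws \<in> lists T" using assms by auto
  then obtain us a vs where "ws = us @ a # vs" "t \<otimes> pr ws = pr (us @ vs)"
    using palindrome_deletion assms(3) by metis
  then show ?thesis using word_length_le[of "us @ vs" X] assms(2) by fastforce
qed

text \<open>
  In a shortest word no palindrome repeats, since multiplying by a repeated one twice would delete two
  letters without changing the value. For simple reflections this says that a
  reduced word lists each inversion exactly once.
\<close>

lemma distinct_palindromes:
  assumes "X \<subseteq> T" "ws \<in> lists X" "length ws = word_length X (pr ws)"
  shows "distinct (palindromes ws)"
  using assms(2,3)
proof (induction ws rule: list.induct)
  case (Cons a ws)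
  have T: "a \<in> T" "ws \<in> lists T" "a \<in> X" "set ws \<subseteq> carrier W" using Cons.prems assms(1) by auto
  have gws: "pr ws \<in> gen X"
    using Cons.prems assms(1) T by (intro word_prod_in_generate) auto
  have "word_length X (a \<otimes> pr ws) \<le> 1 + word_length X (pr ws)"
    using word_length_mult[OF assms(1) generate.incl[OF T(3)] gws]
      word_length_generator[OF T(3) assms(1)] by simp
  then have min: "length ws = word_length X (pr ws)"
    using Cons.prems word_length_le[of ws X] by fastforce
  then have d: "distinct (palindromes ws)" using Cons by auto
  have pc: "set (palindromes ws) \<subseteq> carrier W" using T palindromes_carrier by auto
  have "a \<notin> conjugate a ` set (palindromes ws)"
  proof
    assume "a \<in> conjugate a ` set (palindromes ws)"
    then obtain q where q: "q \<in> set (palindromes ws)" "a = conjugate a q" by blast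
    then have "q = a"
      using T pc conjugate_eq_iff[of a q a] by (auto simp: conjugate_def)
    then have "word_length X (a \<otimes> pr ws) < length ws"
      using word_length_palindrome[OF assms(1) _ q(1)] Cons.prems by auto
    then show False using Cons.prems(2) by simp
  qed
  then show ?case
    using d T pc by (auto simp: distinct_map intro: inj_on_subset[OF inj_on_conjugate])
qed simp

abbreviation len where "len \<equiv> word_length S"

lemma reflection_length_eq: "reflection_length W S w = word_length T w"
  by (simp add: reflection_length_def word_length_def)

lemma simple_subset_reflections: "S \<subseteq> T"
  by auto

lemma generate_reflections: "gen T = carrier W"
  using mono_generate[OF simple_subset_reflections] simple_generate generate_carrier[of T] by blast


section \<open>Canonical generators of reflection subgroups\<close>

text \<open>
  Dyer's canonical generators of a reflection subgroup \<open>M\<close>: the reflections in \<open>M\<close> whose only inversion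
  in \<open>M\<close> is themselves. For \<open>M = W\<close> these are the simple reflections.
\<close>

definition canonical :: "'a set \<Rightarrow> 'a set" where
  "canonical M = {t \<in> T \<inter> M. inversions t \<inter> M \<subseteq> {t}}"

lemma canonical_subset: "canonical M \<subseteq> T" "canonical M \<subseteq> M"
  by (auto simp: canonical_def)

lemma canonical_mem: "v \<in> canonical M \<Longrightarrow> v \<in> T" "v \<in> canonical M \<Longrightarrow> v \<in> M"
  by (auto simp: canonical_def)

lemma canonical_carrier: "canonical M \<subseteq> carrier W"
  using canonical_mem(1) reflection_carrier by blast

lemma inversions_canonical:
  "v \<in> canonical M \<Longrightarrow> q \<in> M \<Longrightarrow> q \<in> inversions v \<longleftrightarrow> q = v"
  using reflection_in_inversions by (auto simp: canonical_def)

lemma canonical_antimono: "v \<in> canonical M \<Longrightarrow> v \<in> N \<Longrightarrow> N \<subseteq> M \<Longrightarrow> v \<in> canonical N"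
  by (auto simp: canonical_def)

lemma simple_canonical: "s \<in> S \<Longrightarrow> s \<in> M \<Longrightarrow> s \<in> canonical M"
  by (auto simp: canonical_def inversions_simple)

lemma subgroup_conjugate_closed:
  "subgroup M W \<Longrightarrow> g \<in> M \<Longrightarrow> a \<in> M \<Longrightarrow> conjugate g a \<in> M"
  by (simp add: conjugate_def subgroup.m_closed subgroup.m_inv_closed)

lemma conjugate_subgroup_self:
  assumes "subgroup M W" "g \<in> M" shows "conjugate g ` M = M"
proof -
  have "g \<in> carrier W" "inv g \<in> M" "M \<subseteq> carrier W"
    using assms subgroup.mem_carrier subgroup.m_inv_closed subgroup.subset by metis+
  then have "m \<in> conjugate g ` M" if "m \<in> M" for m
    using subgroup_conjugate_closed[OF assms(1) \<open>inv g \<in> M\<close> that] that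
    by (intro image_eqI[of _ _ "conjugate (inv g) m"]) auto
  then show ?thesis
    using subgroup_conjugate_closed[OF assms] by blast
qed

text \<open>
  Conjugation by a simple reflection \<open>s \<notin> M\<close> is harmless because \<open>N(s) = {s}\<close> does not meet
  \<open>M\<close>: the cocycle identity then transports the inversions inside \<open>M\<close> without correction.
\<close>

lemma canonical_conjugate_simple_subset:
  assumes "subgroup M W" "s \<in> S" "s \<notin> M"
  shows "conjugate s ` canonical M \<subseteq> canonical (conjugate s ` M)"
proof (rule image_subsetI)
  fix t assume t: "t \<in> canonical M"
  then have tM: "t \<in> M" "t \<in> T" using canonical_subset by auto
  have "q = conjugate s t" if q: "q \<in> inversions (conjugate s t)" "q \<in> conjugate s ` M" for q
  proof -
    obtain p where p: "p \<in> M" "q = conjugate s p" using q by blast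
    then have pc: "p \<in> carrier W" using assms(1) subgroup.mem_carrier by metis
    have "conjugate s p \<noteq> s"
      using p assms pc conjugate_eq_iff[of s p s] by (auto simp: conjugate_def)
    moreover have "conjugate t p \<noteq> s"
      using subgroup_conjugate_closed[OF assms(1) tM(1) p(1)] assms(3) by blast
    moreover have "conjugate s t = s \<otimes> (t \<otimes> s)"
      using assms tM by (simp add: conjugate_def m_assoc)
    ultimately have "q \<in> inversions (conjugate s t) \<longleftrightarrow> p \<in> inversions t"
      using assms p pc tM inversions_mult[of s "t \<otimes> s" q] inversions_mult[of t s p]
        conjugate_inv_cancel(2)[of s p] inversions_simple[of s]
      by auto
    then show ?thesis using q t p inversions_canonical by blast
  qed
  then show "conjugate s t \<in> canonical (conjugate s ` M)"
    using tM assms by (auto simp: canonical_def)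
qed

lemma conjugate_simple_simple: "s \<in> S \<Longrightarrow> a \<in> carrier W \<Longrightarrow> conjugate s (conjugate s a) = a"
  using conjugate_inv_cancel(1)[of s a] by simp

lemma canonical_conjugate_simple:
  assumes "subgroup M W" "s \<in> S" "s \<notin> M"
  shows "canonical (conjugate s ` M) = conjugate s ` canonical M"
proof -
  have sub: "M \<subseteq> carrier W" using assms(1) subgroup.subset by blast
  have twice: "conjugate s ` conjugate s ` A = A" if "A \<subseteq> carrier W" for A
    using that assms(2) by (auto simp: image_image conjugate_simple_simple subset_iff)
  have "s \<notin> conjugate s ` M"
    using assms sub conjugate_eq_iff[of s _ s] by (auto simp: conjugate_def m_assoc)
  then have "conjugate s ` canonical (conjugate s ` M) \<subseteq> canonical M"
    using canonical_conjugate_simple_subset[of "conjugate s ` M" s] assms twice[OF sub]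
      subgroup_conjugate by auto
  then have "conjugate s ` conjugate s ` canonical (conjugate s ` M) \<subseteq> conjugate s ` canonical M"
    by blast
  moreover have "canonical (conjugate s ` M) \<subseteq> carrier W"
    by (rule canonical_carrier)
  ultimately show ?thesis
    using canonical_conjugate_simple_subset[OF assms] twice by auto
qed

text \<open>
  This makes the number of canonical generators an invariant of the conjugacy class of a reflection
  subgroup; for parabolic subgroups it yields the rank.
\<close>

lemma card_canonical_conjugate:
  assumes "subgroup M W" "g \<in> carrier W"
  shows "card (canonical (conjugate g ` M)) = card (canonical M)"
proof -
  have "card (canonical (conjugate (pr ws) ` M)) = card (canonical M)" if "ws \<in> lists S" for ws
    using that
  proof (induction ws rule: list.induct)
    case Nil
    have "conjugate \<one> ` M = M"
      using assms(1) subgroup.mem_carrier by (metis conjugate_one image_cong image_ident)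
    then show ?case by simp
  next
    case (Cons s ws)
    let ?N = "conjugate (pr ws) ` M"
    have w: "pr ws \<in> carrier W" "s \<in> S" using Cons.prems by (auto intro!: word_prod_closed)
    then have N: "subgroup ?N W" using subgroup_conjugate assms(1) by auto
    have "conjugate (pr (s # ws)) ` M = conjugate s ` ?N"
      using w assms(1) subgroup.mem_carrier[OF assms(1)]
      by (simp add: image_image conjugate_conjugate)
    moreover have "card (canonical (conjugate s ` ?N)) = card (canonical ?N)"
    proof (cases "s \<in> ?N")
      case True
      then show ?thesis using conjugate_subgroup_self[OF N] by simp
    next
      case False
      have "inj_on (conjugate s) (canonical ?N)"
        using w by (intro inj_on_subset[OF inj_on_conjugate] canonical_carrier) auto
      then show ?thesis
        using canonical_conjugate_simple[OF N w(2) False] by (simp add: card_image)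
    qed
    ultimately show ?case using Cons by simp
  qed
  then show ?thesis using simple_word[OF assms(2)] by metis
qed

text \<open>
  Induction on a word \<open>a\<^sub>1 \<cdots> a\<^sub>k\<close> with \<open>t = a\<^sub>1 \<cdots> a\<^sub>k s (a\<^sub>1 \<cdots> a\<^sub>k)\<^sup>-\<^sup>1\<close>, for all subgroups at
  once. If the first letter \<open>a\<close> lies in \<open>M\<close>, it is itself canonical in \<open>M\<close> and can be stripped; otherwise
  \<open>M\<close> is replaced by \<open>a M a\<close>, whose canonical generators are those of \<open>M\<close> conjugated by \<open>a\<close>.
\<close>

lemma reflection_conjugate_canonical:
  assumes "subgroup M W" "t \<in> T" "t \<in> M"
  shows "\<exists>d\<in>gen (canonical M). \<exists>v\<in>canonical M. t = conjugate d v"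
proof -
  have "\<exists>d\<in>gen (canonical M). \<exists>v\<in>canonical M. t = conjugate d v"
    if "ws \<in> lists S" "s \<in> S" "t = conjugate (pr ws) s" "t \<in> M" "subgroup M W" for ws s t M
    using that
  proof (induction ws arbitrary: t M rule: list.induct)
    case Nil
    then show ?case
      using simple_canonical by (intro bexI[of _ \<one>] bexI[of _ s]) (auto intro: generate.one)
  next
    case (Cons a ws)
    let ?t = "conjugate (pr ws) s"
    have a: "a \<in> S" "pr ws \<in> carrier W" "ws \<in> lists S" using Cons.prems by (auto intro!: word_prod_closed)
    have t: "t = conjugate a ?t" "?t = conjugate a t"
      using Cons.prems a by (simp_all add: conjugate_conjugate flip: m_assoc)
    show ?case
    proof (cases "a \<in> M")
      case True
      then have "?t \<in> M" using t Cons.prems subgroup_conjugate_closed by metis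
      then obtain d v where dv: "d \<in> gen (canonical M)" "v \<in> canonical M" "?t = conjugate d v"
        using Cons.IH[OF a(3) Cons.prems(2) HOL.refl _ Cons.prems(5)] by blast
      have "a \<otimes> d \<in> gen (canonical M)"
        using dv True a simple_canonical by (blast intro: generate.intros)
      moreover have "d \<in> carrier W" "v \<in> carrier W"
        using dv canonical_carrier generate_carrier[OF canonical_subset(1)] by blast+
      ultimately show ?thesis
        using t(1) dv a by (metis conjugate_conjugate simple_carrier)
    next
      case False
      have "?t \<in> conjugate a ` M" using t(2) Cons.prems by blast
      moreover have "subgroup (conjugate a ` M) W" using subgroup_conjugate Cons.prems a by auto
      ultimately obtain d v where dv: "d \<in> gen (conjugate a ` canonical M)"
        "v \<in> conjugate a ` canonical M" "?t = conjugate d v"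
        using Cons.IH[OF a(3) Cons.prems(2) HOL.refl, of "conjugate a ` M"]
          canonical_conjugate_simple[OF Cons.prems(5) a(1) False] by metis
      have cc: "canonical M \<subseteq> carrier W" by (rule canonical_carrier)
      then obtain d' v' where dv': "d' \<in> gen (canonical M)" "d = conjugate a d'"
          "v' \<in> canonical M" "v = conjugate a v'"
        using dv generate_conjugate[of a "canonical M"] a by auto
      have c: "d' \<in> carrier W" "v' \<in> carrier W"
        using dv' cc generate_carrier canonical_subset by blast+
      have "conjugate a (conjugate d v) = conjugate d' v'"
        using c a dv' by (simp add: conjugate_def inv_mult_group m_assoc)
      then show ?thesis using t(1) dv(3) dv' by auto
    qed
  qed
  then show ?thesis using assms by (metis reflectionsE simple_word)
qed

lemma canonical_generates:
  assumes "A \<subseteq> T" shows "gen (canonical (gen A)) = gen A"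
proof (rule generate_eqI)
  have M: "subgroup (gen A) W" using assms generate_subgroup by auto
  show "canonical (gen A) \<subseteq> gen A" using canonical_subset by auto
  show "A \<subseteq> gen (canonical (gen A))"
  proof
    fix t assume t: "t \<in> A"
    have "t \<in> T" "t \<in> gen A" using t assms by (auto intro: generate.incl)
    then obtain d v where dv: "d \<in> gen (canonical (gen A))" "v \<in> canonical (gen A)"
      "t = conjugate d v"
      using reflection_conjugate_canonical[OF M] by meson
    moreover have "subgroup (gen (canonical (gen A))) W"
      using generate_subgroup canonical_subset by auto
    ultimately show "t \<in> gen (canonical (gen A))"
      using subgroup_conjugate_closed generate.incl by metis
  qed
qed (use assms canonical_carrier in auto)

text \<open>
  Words in canonical generators of \<open>M\<close> compute the inversions inside \<open>M\<close> just as words in simple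
  reflections compute all inversions. This gives \<open>M\<close> the exchange property of a Coxeter group.
\<close>

lemma inversions_canonical_word:
  assumes "subgroup M W" "ws \<in> lists (canonical M)" "q \<in> M"
  shows "q \<in> inversions (pr ws) \<longleftrightarrow> odd (count_list (palindromes ws) q)"
  using assms(2,3)
proof (induction ws arbitrary: q rule: list.induct)
  case (Cons v ws)
  have v: "v \<in> canonical M" "v \<in> T" "v \<in> M" "ws \<in> lists T" "set ws \<subseteq> carrier W"
    using Cons.prems by (auto dest: canonical_mem(1) canonical_mem(2) subsetD[OF canonical_carrier])
  have q: "q \<in> carrier W" "conjugate v q \<in> M"
    using Cons.prems assms(1) subgroup.mem_carrier subgroup_conjugate_closed v by metis+
  have "count_list (map (conjugate v) (palindromes ws)) q = count_list (palindromes ws) (conjugate v q)"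
    using count_map_conjugate[of v "palindromes ws" q] v q palindromes_carrier by simp
  then show ?case
    using inversions_mult[of v "pr ws" q] v q Cons inversions_canonical by auto
qed simp

lemma word_length_inversion:
  assumes "subgroup M W" "X \<subseteq> canonical M" "d \<in> gen X" "t \<in> M" "t \<in> inversions d"
  shows "word_length X (t \<otimes> d) < word_length X d"
proof -
  have X: "X \<subseteq> T" using assms(2) canonical_subset by blast
  obtain ws where ws: "ws \<in> lists X" "pr ws = d" "length ws = word_length X d"
    using word_length_attained[OF X assms(3)] .
  have "ws \<in> lists (canonical M)" using ws assms(2) by auto
  then have "t \<in> set (palindromes ws)"
    using inversions_canonical_word[OF assms(1)] ws assms by (metis count_notin even_zero)
  then show ?thesis using word_length_palindrome[OF X ws(1)] ws by simp
qed

lemma inversion_iff_word_length: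
  assumes "subgroup M W" "X \<subseteq> canonical M" "d \<in> gen X" "t \<in> T" "t \<in> gen X"
  shows "t \<in> inversions d \<longleftrightarrow> word_length X (t \<otimes> d) < word_length X d"
proof
  have X: "X \<subseteq> T" using assms(2) canonical_subset by blast
  have "gen X \<subseteq> M" using assms generate_subset_subgroup canonical_subset by blast
  then have tM: "t \<in> M" using assms by blast
  have d: "d \<in> carrier W" using assms X generate_carrier by blast
  show "word_length X (t \<otimes> d) < word_length X d" if "t \<in> inversions d"
    using word_length_inversion assms tM that by blast
  show "t \<in> inversions d" if lt: "word_length X (t \<otimes> d) < word_length X d"
  proof (rule ccontr)
    assume "t \<notin> inversions d"
    then have "t \<in> inversions (t \<otimes> d)" using inversions_reflection_mult assms d by blast
    moreover have "t \<otimes> d \<in> gen X" using assms generate.eng by metis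
    ultimately have "word_length X (t \<otimes> (t \<otimes> d)) < word_length X (t \<otimes> d)"
      using word_length_inversion assms tM by blast
    then show False using lt assms d by simp
  qed
qed

lemma palindromes_subgroup:
  assumes "subgroup M W" "set ws \<subseteq> M" shows "set (palindromes ws) \<subseteq> M"
  using assms(2) by (induction ws) (auto intro: subgroup_conjugate_closed[OF assms(1)])

lemma distinct_count_list: "distinct xs \<Longrightarrow> x \<in> set xs \<Longrightarrow> count_list xs x = 1"
  by (induction xs) auto

text \<open>
  Take a shortest word in \<open>X\<close> for a canonical generator \<open>v\<close>. Its palindromes are distinct inversions of
  \<open>v\<close> in the subgroup, but \<open>v\<close> is its only such inversion; so the word has one letter.
\<close>

lemma canonical_eqI:
  assumes "X \<subseteq> canonical (gen X)" shows "canonical (gen X) = X"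
proof
  show "canonical (gen X) \<subseteq> X"
  proof
    fix v assume v: "v \<in> canonical (gen X)"
    have X: "X \<subseteq> T" using assms canonical_subset by blast
    have M: "subgroup (gen X) W" using generate_subgroup X by blast
    obtain ws where ws: "ws \<in> lists X" "pr ws = v" "length ws = word_length X v"
      using word_length_attained[OF X] v canonical_subset by blast
    have dist: "distinct (palindromes ws)" using distinct_palindromes[OF X] ws by simp
    have "q = v" if q: "q \<in> set (palindromes ws)" for q
    proof -
      have "set ws \<subseteq> gen X" using ws(1) by (auto intro: generate.incl)
      then have "q \<in> gen X" using palindromes_subgroup[OF M] q by blast
      moreover have "odd (count_list (palindromes ws) q)"
        using q dist by (simp add: distinct_count_list)
      moreover have "ws \<in> lists (canonical (gen X))" using ws assms by auto
      ultimately have "q \<in> inversions v"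
        using inversions_canonical_word[OF M] ws(2) by metis
      then show ?thesis using inversions_canonical[OF v] \<open>q \<in> gen X\<close> by simp
    qed
    then have "set (palindromes ws) \<subseteq> {v}" by blast
    then have "length ws \<le> 1"
      using distinct_card[OF dist] card_mono[of "{v}" "set (palindromes ws)"] by simp
    moreover have "ws \<noteq> []" using ws v canonical_subset reflection_neq_one by fastforce
    ultimately obtain a where "ws = [a]" by (cases ws) auto
    then show "v \<in> X" using ws X by auto
  qed
qed (rule assms)


section \<open>Length in cosets of reflection subgroups\<close>

lemma simple_canonical_carrier: "S \<subseteq> canonical (carrier W)"
  using simple_canonical by auto

lemma len_left: "t \<in> T \<Longrightarrow> w \<in> carrier W \<Longrightarrow> t \<in> inversions w \<longleftrightarrow> len (t \<otimes> w) < len w"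
  using inversion_iff_word_length[OF subgroup_self simple_canonical_carrier, of w t]
  by (simp add: simple_generate)

lemma len_inv: "w \<in> carrier W \<Longrightarrow> len (inv w) = len w"
  using word_length_inv[OF simple_subset_reflections] simple_generate by simp

lemma len_right:
  assumes "t \<in> T" "w \<in> carrier W"
  shows "t \<in> inversions (inv w) \<longleftrightarrow> len (w \<otimes> t) < len w"
proof -
  have "inv (w \<otimes> t) = t \<otimes> inv w" using assms by (simp add: inv_mult_group)
  then show ?thesis
    using len_left[of t "inv w"] len_inv[of w] len_inv[of "w \<otimes> t"] assms by simp
qed

lemma len_right_increase:
  assumes "t \<in> T" "w \<in> carrier W" "t \<notin> inversions (inv w)"
  shows "len w < len (w \<otimes> t)"
proof -
  have "inv (w \<otimes> t) = t \<otimes> inv w" using assms by (simp add: inv_mult_group)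
  then have "t \<in> inversions (inv (w \<otimes> t))"
    using inversions_reflection_mult[of t "inv w"] assms by simp
  then show ?thesis using len_right[of t "w \<otimes> t"] assms by (simp add: m_assoc)
qed

lemma minimal_prefix:
  assumes "X \<subseteq> T" "us @ vs \<in> lists X" "length (us @ vs) = word_length X (pr (us @ vs))"
  shows "length us = word_length X (pr us)" "length vs = word_length X (pr vs)"
proof -
  have sub: "us \<in> lists X" "vs \<in> lists X" "set us \<subseteq> carrier W" "set vs \<subseteq> carrier W" "X \<subseteq> carrier W"
    using assms by auto
  then have "pr us \<in> gen X" "pr vs \<in> gen X"
    by (auto intro!: word_prod_in_generate)
  then have "word_length X (pr (us @ vs)) \<le> word_length X (pr us) + word_length X (pr vs)"
    using word_length_mult[OF assms(1)] sub by (simp add: word_prod_append)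
  moreover have "word_length X (pr us) \<le> length us" "word_length X (pr vs) \<le> length vs"
    using sub word_length_le by auto
  ultimately show "length us = word_length X (pr us)" "length vs = word_length X (pr vs)"
    using assms(3) by auto
qed

text \<open>
  The inverse of a shortest element of the coset has no inversion in \<open>M\<close>: multiplying the element
  on the right by such an inversion would shorten it without leaving the coset.
\<close>

lemma minimal_coset_representative:
  assumes "subgroup M W" "y \<in> carrier W"
  obtains z d where "z \<in> carrier W" "d \<in> M" "y = z \<otimes> d" "inversions (inv z) \<inter> M = {}"
    "\<And>m. m \<in> M \<Longrightarrow> len z \<le> len (z \<otimes> m)"
proof -
  obtain k where k: "k \<in> M" "\<And>m. m \<in> M \<Longrightarrow> len (y \<otimes> k) \<le> len (y \<otimes> m)"
    using ex_has_least_nat[of "\<lambda>m. m \<in> M" \<one> "\<lambda>m. len (y \<otimes> m)"] subgroup.one_closed[OF assms(1)]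
    by blast
  have MC: "m \<in> carrier W" if "m \<in> M" for m using subgroup.mem_carrier assms(1) that by metis
  have min: "len (y \<otimes> k) \<le> len (y \<otimes> k \<otimes> m)" if "m \<in> M" for m
    using k(2)[of "k \<otimes> m"] subgroup.m_closed[OF assms(1) k(1) that] assms MC k that
    by (simp add: m_assoc)
  have "t \<notin> inversions (inv (y \<otimes> k))" if "t \<in> M" for t
    using min[OF that] len_right[of t "y \<otimes> k"] inversions_reflections[of "inv (y \<otimes> k)"] assms k MC
    by fastforce
  then show thesis
    using that[of "y \<otimes> k" "inv k"] k MC assms min subgroup.m_inv_closed[OF assms(1)]
    by (auto simp: m_assoc)
qed

lemma inversions_coset:
  assumes "subgroup M W" "z \<in> carrier W" "inversions (inv z) \<inter> M = {}" "d \<in> M" "t \<in> M"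
  shows "t \<in> inversions (inv (z \<otimes> d)) \<longleftrightarrow> t \<in> inversions (inv d)"
proof -
  have "d \<in> carrier W" "t \<in> carrier W" "conjugate d t \<in> M"
    using assms subgroup.mem_carrier subgroup_conjugate_closed by metis+
  then show ?thesis
    using inversions_mult[of "inv d" "inv z" t] assms by (auto simp: inv_mult_group)
qed

text \<open>
  Along a coset \<open>z M\<close> with \<open>z\<close> minimal, the length in \<open>W\<close> strictly increases with shortest words in
  canonical generators. This is how length statements inside \<open>M\<close> pass to \<open>W\<close>.
\<close>

lemma len_coset_increase:
  assumes M: "subgroup M W" and X: "X \<subseteq> canonical M"
    and z: "z \<in> carrier W" "inversions (inv z) \<inter> M = {}"
    and "us @ vs \<in> lists X" "length (us @ vs) = word_length X (pr (us @ vs))" "vs \<noteq> []"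
  shows "len (z \<otimes> pr us) < len (z \<otimes> pr (us @ vs))"
  using assms(5-7)
proof (induction vs rule: rev_induct)
  case (snoc v vs)
  let ?d = "pr (us @ vs)"
  have XT: "X \<subseteq> T" using X canonical_subset by blast
  have v: "v \<in> X" "us @ vs \<in> lists X" "(us @ vs) @ [v] \<in> lists X"
    using snoc.prems by auto
  have vT: "v \<in> T" "v \<in> M" using v(1) X canonical_mem by blast+
  have "X \<subseteq> carrier W" using XT by auto
  then have car: "set (us @ vs) \<subseteq> carrier W" "set us \<subseteq> carrier W"
    using v(2) by auto
  have dg: "?d \<in> gen X" using v(2) \<open>X \<subseteq> carrier W\<close> by (intro word_prod_in_generate) auto
  have dC: "?d \<in> carrier W" "pr us \<in> carrier W" using car by (auto simp del: set_append)
  have genM: "gen X \<subseteq> M" using generate_subset_subgroup[OF M] X canonical_subset by blast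
  have prod: "pr (us @ vs @ [v]) = ?d \<otimes> v"
    using word_prod_append[of "us @ vs" "[v]"] car vT by simp
  have min: "length (us @ vs) = word_length X ?d"
    using minimal_prefix(1)[OF XT v(3)] snoc.prems by simp
  have "v \<notin> inversions (inv ?d)"
  proof
    assume "v \<in> inversions (inv ?d)"
    moreover have "inv ?d \<in> gen X" using dg \<open>X \<subseteq> carrier W\<close> generate_m_inv_closed[of X ?d] by simp
    ultimately have "word_length X (v \<otimes> inv ?d) < word_length X ?d"
      using word_length_inversion[OF M X, of "inv ?d" v] vT word_length_inv[OF XT dg] by simp
    moreover have "inv (?d \<otimes> v) = v \<otimes> inv ?d" using dC vT by (simp add: inv_mult_group)
    moreover have "?d \<otimes> v \<in> gen X" using dg v by (metis generate.incl generate.eng)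
    ultimately have "word_length X (?d \<otimes> v) < word_length X ?d"
      using word_length_inv[OF XT] by metis
    then show False using min snoc.prems(2) prod by simp
  qed
  then have "v \<notin> inversions (inv (z \<otimes> ?d))"
    using inversions_coset[OF M z, of ?d v] dg genM vT by blast
  then have less: "len (z \<otimes> ?d) < len (z \<otimes> ?d \<otimes> v)"
    using len_right_increase vT z dC by simp
  show ?case
  proof (cases "vs = []")
    case True
    then show ?thesis using less prod dC z vT by (simp add: m_assoc)
  next
    case False
    then have "len (z \<otimes> pr us) < len (z \<otimes> ?d)" using snoc.IH v(2) min by simp
    then show ?thesis using less prod dC z vT by (simp add: m_assoc)
  qed
qed simp

section \<open>Dihedral reflection subgroups\<close>

text \<open>
  The orbit of the factorization \<open>a b\<close> under the Hurwitz action of the braid group on two strands.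
\<close>

inductive hurwitz :: "'a \<Rightarrow> 'a \<Rightarrow> 'a \<Rightarrow> 'a \<Rightarrow> bool" for a b where
  start: "hurwitz a b a b"
| forward: "hurwitz a b c c' \<Longrightarrow> hurwitz a b c' (conjugate c' c)"
| backward: "hurwitz a b c c' \<Longrightarrow> hurwitz a b (conjugate c c') c"

lemma generate_pair_conjugate:
  assumes "c \<in> T" "c' \<in> T"
  shows "gen {c', conjugate c' c} = gen {c, c'}"
proof (rule generate_eqI)
  have M: "subgroup (gen {c, c'}) W" "subgroup (gen {c', conjugate c' c}) W"
    using assms by (auto intro!: generate_subgroup)
  show "{c', conjugate c' c} \<subseteq> gen {c, c'}"
    using subgroup_conjugate_closed[OF M(1), of c' c] by (auto intro: generate.incl)
  have "conjugate c' (conjugate c' c) = c"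
    using assms conjugate_inv_cancel(1)[of c' c] by simp
  then show "{c, c'} \<subseteq> gen {c', conjugate c' c}"
    using subgroup_conjugate_closed[OF M(2), of c' "conjugate c' c"] generate.incl[of _ "{c', conjugate c' c}" W]
    by auto
qed (use assms in auto)

lemma hurwitz_invariant:
  assumes "hurwitz a b c c'" "a \<in> T" "b \<in> T"
  shows "c \<in> T \<and> c' \<in> T \<and> c \<otimes> c' = a \<otimes> b \<and> gen {c, c'} = gen {a, b}"
  using assms(1)
proof induction
  case (forward c c')
  then have "c' \<otimes> conjugate c' c = c \<otimes> c'" using assms by (simp add: conjugate_def m_assoc)
  then show ?case using forward generate_pair_conjugate[of c c'] by auto
next
  case (backward c c')
  then have "conjugate c c' \<otimes> c = c \<otimes> c'" using assms by (simp add: conjugate_def m_assoc)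
  moreover have "gen {conjugate c c', c} = gen {c, c'}"
    using backward generate_pair_conjugate[of c' c] by (simp add: insert_commute)
  ultimately show ?case using backward by auto
qed (use assms in auto)

text \<open>
  The set of first components \<open>c\<close> of pairs in the Hurwitz orbit and its translate by \<open>a\<close> together are
  stable under left multiplication by \<open>a\<close> and \<open>b\<close>, because \<open>a b c = c c' c\<close> and \<open>b a c = c'\<close>
  whenever \<open>c c' = a b\<close>.
\<close>

lemma dihedral_element:
  assumes "a \<in> T" "b \<in> T" "d \<in> gen {a, b}"
  shows "(\<exists>c'. hurwitz a b d c') \<or> (\<exists>c c'. hurwitz a b c c' \<and> d = a \<otimes> c)"
proof -
  have "(\<exists>c'. hurwitz a b (pr ws) c') \<or> (\<exists>c c'. hurwitz a b c c' \<and> pr ws = a \<otimes> c)"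
    if "ws \<in> lists {a, b}" for ws
    using that
  proof (induction ws rule: list.induct)
    case Nil
    then show ?case using hurwitz.start assms by force
  next
    case (Cons x ws)
    then consider c' where "hurwitz a b (pr ws) c'" | c c' where "hurwitz a b c c'" "pr ws = a \<otimes> c"
      by auto
    then show ?case
    proof cases
      case 1
      let ?c = "pr ws"
      have inv: "?c \<in> T" "c' \<in> T" "?c \<otimes> c' = a \<otimes> b" using hurwitz_invariant[OF 1] assms by auto
      have "b \<otimes> ?c = a \<otimes> (a \<otimes> b \<otimes> ?c)" using assms inv by (simp add: m_assoc)
      also have "a \<otimes> b \<otimes> ?c = conjugate ?c c'" using inv by (simp add: conjugate_def flip: inv(3))
      finally show ?thesis using 1 hurwitz.backward[OF 1] Cons.prems by auto
    next
      case 2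
      have inv: "c \<in> T" "c' \<in> T" "c \<otimes> c' = a \<otimes> b" using hurwitz_invariant[OF 2(1)] assms by auto
      have "inv (c \<otimes> c') = c' \<otimes> c" "inv (a \<otimes> b) = b \<otimes> a"
        using inv(1,2) assms by (simp_all add: inv_mult_group)
      then have "b \<otimes> a = c' \<otimes> c" using inv(3) by simp
      then have "b \<otimes> (a \<otimes> c) = c'" using inv assms by (simp add: m_assoc flip: m_assoc[of b a c])
      moreover have "a \<otimes> (a \<otimes> c) = c" using inv assms by simp
      ultimately show ?thesis
        using 2 hurwitz.forward[OF 2(1)] Cons.prems by auto
    qed
  qed
  then show ?thesis using generate_word[of "{a, b}" d] assms by (metis insert_subset empty_subsetI)
qed

text \<open>
  An element \<open>a c\<close> of the translate is even, so an odd element is itself a first component. Hence the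
  first factor of a factorization of \<open>a b\<close> may be prescribed among the odd elements.
\<close>

lemma dihedral_odd:
  assumes "a \<in> T" "b \<in> T" "d \<in> gen {a, b}" "odd_elt d"
  obtains c' where "hurwitz a b d c'"
proof -
  have "\<not> odd_elt (a \<otimes> c)" if "hurwitz a b c c'" for c c'
    using hurwitz_invariant[OF that] assms by (auto simp: odd_elt_mult)
  then show thesis using dihedral_element[OF assms(1-3)] assms(4) that by metis
qed

text \<open>
  Comparing the inversions of \<open>x y x\<close> computed by the cocycle identity with its single inversion inside
  \<open>M\<close> leaves only the possibility \<open>y x y = x\<close>.
\<close>

lemma canonical_conjugate_commute:
  assumes "subgroup M W" "x \<in> canonical M" "y \<in> canonical M" "conjugate x y \<in> canonical M" "x \<noteq> y"
  shows "x \<otimes> y = y \<otimes> x"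
proof -
  have t: "x \<in> T" "y \<in> T" "x \<in> M" "y \<in> M" using assms canonical_mem by auto
  have yx: "conjugate y x \<in> M" using subgroup_conjugate_closed[OF assms(1)] t by simp
  have "x \<noteq> conjugate x y"
    using assms(5) t conjugate_eq_iff[of x y x] by (auto simp: conjugate_def)
  moreover have "conjugate x y = x \<otimes> (y \<otimes> x)" "conjugate x x = x"
    using t by (simp_all add: conjugate_def m_assoc)
  moreover have "x \<in> inversions (x \<otimes> (y \<otimes> x)) \<longleftrightarrow> x \<notin> inversions (y \<otimes> x)"
    using inversions_reflection_mult t by simp
  moreover have "x \<in> inversions (y \<otimes> x) \<longleftrightarrow> conjugate y x = x"
    using inversions_mult[of y x x] t yx inversions_canonical[OF assms(2)]
      inversions_canonical[OF assms(3)] assms(5) by auto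
  ultimately have "conjugate y x = x"
    using inversions_canonical[OF assms(4), of x] t by auto
  then have "y \<otimes> x \<otimes> y \<otimes> y = x \<otimes> y" using t by (simp add: conjugate_def)
  then show ?thesis using t by (simp add: m_assoc)
qed

text \<open>
  A product of three reflections in a dihedral group is an involution, so \<open>x z y = y z x\<close>. Evaluating
  whether \<open>y\<close> is an inversion from both expressions gives \<open>z x y x z = y\<close>, and together with the
  equation this makes \<open>x\<close> and \<open>z\<close> commute.
\<close>

lemma dihedral_canonical_commute:
  assumes ab: "a \<in> T" "b \<in> T" and D: "D = gen {a, b}"
    and xyz: "x \<in> canonical D" "y \<in> canonical D" "z \<in> canonical D" "x \<noteq> y" "y \<noteq> z" "x \<noteq> z"
  shows "x \<otimes> z = z \<otimes> x"
proof -
  have sub: "subgroup D W" using ab D generate_subgroup by simp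
  have t: "x \<in> T" "y \<in> T" "z \<in> T" "x \<in> D" "y \<in> D" "z \<in> D" using xyz canonical_mem by auto
  have mem: "x \<otimes> (z \<otimes> y) \<in> D" "conjugate x y \<in> D" "conjugate z y \<in> D" "conjugate z (conjugate x y) \<in> D"
    using t sub by (simp_all add: subgroup.m_closed subgroup_conjugate_closed)
  moreover have "odd_elt (x \<otimes> (z \<otimes> y))" using t by (simp add: odd_elt_mult)
  ultimately have "x \<otimes> (z \<otimes> y) \<in> T"
    using dihedral_odd[OF ab] hurwitz_invariant ab D by metis
  then have "inv (x \<otimes> (z \<otimes> y)) = x \<otimes> (z \<otimes> y)" by (rule reflection_inv)
  moreover have "inv (x \<otimes> (z \<otimes> y)) = y \<otimes> (z \<otimes> x)" using t by (simp add: inv_mult_group m_assoc)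
  ultimately have rev: "x \<otimes> (z \<otimes> y) = y \<otimes> (z \<otimes> x)" by simp
  have no1: "conjugate x y \<noteq> z"
  proof
    assume c: "conjugate x y = z"
    then have "x \<otimes> y = y \<otimes> x" using canonical_conjugate_commute[OF sub xyz(1,2)] xyz by simp
    then have "conjugate x y = y" using t by (simp add: conjugate_def m_assoc)
    then show False using c xyz by simp
  qed
  have no2: "conjugate z y \<noteq> x"
  proof
    assume c: "conjugate z y = x"
    then have "z \<otimes> y = y \<otimes> z" using canonical_conjugate_commute[OF sub xyz(3,2)] xyz by simp
    then have "conjugate z y = y" using t by (simp add: conjugate_def m_assoc)
    then show False using c xyz by simp
  qed
  (* decide in two ways whether y is an inversion of x z y = y z x *)
  note inv = xyz(1-3)[THEN inversions_canonical]
  have "y \<in> inversions (x \<otimes> (z \<otimes> y)) \<longleftrightarrow> conjugate x y \<in> inversions (z \<otimes> y)"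
    using inversions_mult[of x "z \<otimes> y" y] t inv(1)[of y] xyz by simp
  also have "\<dots> \<longleftrightarrow> conjugate z (conjugate x y) = y"
    using inversions_mult[of z y "conjugate x y"] t inv(3)[of "conjugate x y"] no1
      inv(2)[OF mem(4)] mem by simp
  finally have 1: "y \<in> inversions (x \<otimes> (z \<otimes> y)) \<longleftrightarrow> conjugate z (conjugate x y) = y" .
  have "y \<in> inversions (z \<otimes> x) \<longleftrightarrow> False"
    using inversions_mult[of z x y] t inv(3)[of y] inv(1)[OF mem(3)] no2 xyz by simp
  then have "y \<in> inversions (y \<otimes> (z \<otimes> x))"
    using inversions_reflection_mult[of y "z \<otimes> x"] t by simp
  then have "conjugate z (conjugate x y) = y" using 1 rev by simp
  then have "conjugate x y = conjugate z y"
    using conjugate_eq_iff[of z "conjugate x y" y] t by simp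
  then have e: "x \<otimes> (y \<otimes> x) = z \<otimes> (y \<otimes> z)" using t by (simp add: conjugate_def m_assoc)
  have "y \<otimes> (x \<otimes> z) = x \<otimes> (x \<otimes> (y \<otimes> x)) \<otimes> z" using t by (simp add: m_assoc)
  also have "\<dots> = x \<otimes> (z \<otimes> y)" unfolding e using t by (simp add: m_assoc)
  also have "\<dots> = y \<otimes> (z \<otimes> x)" by (rule rev)
  finally show ?thesis using t by simp
qed

lemma generate_commute:
  assumes X: "X \<subseteq> T" and comm: "\<And>p q. p \<in> X \<Longrightarrow> q \<in> X \<Longrightarrow> p \<otimes> q = q \<otimes> p"
    and "d \<in> gen X" "e \<in> gen X"
  shows "d \<otimes> e = e \<otimes> d"
proof -
  have step: "pr ws \<otimes> u = u \<otimes> pr ws"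
    if "ws \<in> lists X" "u \<in> carrier W" "\<And>p. p \<in> X \<Longrightarrow> p \<otimes> u = u \<otimes> p" for ws u
    using that(1)
  proof (induction ws rule: list.induct)
    case (Cons p ws)
    then have c: "p \<in> carrier W" "pr ws \<in> carrier W" "p \<in> X" using X by (auto intro!: word_prod_closed)
    then have "p \<otimes> pr ws \<otimes> u = p \<otimes> u \<otimes> pr ws" using Cons that(2) by (simp add: m_assoc)
    also have "\<dots> = u \<otimes> (p \<otimes> pr ws)" using c that by (simp add: m_assoc)
    finally show ?case by simp
  qed (use that in simp)
  have c: "d \<in> carrier W" "p \<in> X \<Longrightarrow> p \<in> carrier W" for p
    using assms(3) X generate_carrier[OF X] by auto
  obtain us vs where uv: "us \<in> lists X" "pr us = d" "vs \<in> lists X" "pr vs = e"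
    using generate_word[OF X] assms by metis
  have "p \<otimes> d = d \<otimes> p" if "p \<in> X" for p
    using step[OF uv(1), of p] comm c that uv by simp
  then show ?thesis using step[OF uv(3), of d] c uv by simp
qed

text \<open>
  With three canonical generators, any two would commute by
  \<open>dihedral_canonical_commute\<close>; the group would be
  abelian and contain only the two reflections \<open>a\<close> and \<open>b\<close>, a contradiction. With at most one, the
  group would contain at most one reflection.
\<close>

lemma dihedral_canonical_pair:
  assumes ab: "a \<in> T" "b \<in> T" "a \<noteq> b"
  obtains p q where "p \<noteq> q" "canonical (gen {a, b}) = {p, q}"
proof -
  define D where "D = gen {a, b}"
  have CT: "canonical D \<subseteq> T" by (rule canonical_subset)
  have gen: "gen (canonical D) = D" using canonical_generates[of "{a, b}"] ab D_def by simp
  have abD: "a \<in> D" "b \<in> D" unfolding D_def by (auto intro: generate.incl)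
  have no3: False if xyz: "x \<in> canonical D" "y \<in> canonical D" "z \<in> canonical D" "x \<noteq> y" "y \<noteq> z" "x \<noteq> z"
    for x y z
  proof -
    have "p \<otimes> q = q \<otimes> p" if "p \<in> canonical D" "q \<in> canonical D" for p q
    proof (cases "p = q")
      case False
      obtain r where "r \<in> canonical D" "r \<noteq> p" "r \<noteq> q" using xyz by metis
      then show ?thesis
        using dihedral_canonical_commute[OF ab(1,2) D_def, of p r q] that False by auto
    qed simp
    then have comm: "a \<otimes> b = b \<otimes> a" using generate_commute[OF CT] abD gen by metis
    have "c = a \<and> c' = b \<or> c = b \<and> c' = a" if "hurwitz a b c c'" for c c'
      using that
    proof induction
      case (forward c c')
      then show ?case using ab comm by (auto simp: conjugate_def m_assoc)
    next
      case (backward c c')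
      then show ?case using ab comm by (auto simp: conjugate_def m_assoc)
    qed simp
    moreover have "\<exists>c'. hurwitz a b c c'" if "c \<in> canonical D" for c
      using dihedral_odd[OF ab(1,2), of c] canonical_mem[OF that] D_def by auto
    ultimately have "c \<in> {a, b}" if "c \<in> canonical D" for c
      using that by blast
    then show False using xyz by blast
  qed
  obtain p where p: "p \<in> canonical D"
  proof (cases "canonical D = {}")
    case True
    then have "D = {\<one>}" using gen generate_empty by simp
    then show thesis using abD ab reflection_neq_one by auto
  qed (use that in blast)
  obtain q where q: "q \<in> canonical D" "q \<noteq> p"
  proof (cases "canonical D = {p}")
    case True
    have "c = p" if c: "c \<in> D" "c \<in> T" for c
    proof -
      obtain ws where ws: "ws \<in> lists {p}" "pr ws = c"
        using generate_word[of "{p}" c] gen True c CT by metis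
      have "pr ws \<in> {\<one>, p}" using ws(1) CT p by (induction ws rule: list.induct) auto
      then show ?thesis using ws c reflection_neq_one by auto
    qed
    then show thesis using abD ab by metis
  qed (use p that in blast)
  have "canonical D = {p, q}" using no3 p q by blast
  then show thesis using that q D_def by metis
qed

section \<open>Ascending reflection factorizations\<close>

text \<open>
  Write \<open>y = z d\<close> with \<open>z\<close> minimal in \<open>y D\<close>, where \<open>D\<close> is the dihedral group generated by \<open>a\<close> and
  \<open>b\<close>. If \<open>d\<close> is even, go down to \<open>z\<close>. If \<open>d\<close> is odd, then it is not a canonical generator \<open>v\<close> of \<open>D\<close>,
  because \<open>a\<close> and \<open>b\<close> are both inversions of \<open>d\<^sup>-\<^sup>1\<close>, while \<open>v\<^sup>-\<^sup>1 = v\<close> has no inversion in \<open>D\<close>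
  but itself; so go down to \<open>z v\<close> for the first letter \<open>v\<close> of a shortest word for \<open>d\<close>.
  Evenness of \<open>e\<close> makes \<open>a e\<close> a reflection again.
\<close>

lemma peak_descent:
  assumes ab: "a \<in> T" "b \<in> T" "a \<noteq> b" and y: "y \<in> carrier W"
    and less: "len (y \<otimes> a) < len y" "len (y \<otimes> b) < len y"
  obtains e where "e \<in> gen {a, b}" "\<not> odd_elt e" "len (y \<otimes> e) < len y"
proof -
  define D where "D = gen {a, b}"
  have D: "subgroup D W" using ab D_def generate_subgroup by simp
  have abD: "a \<in> D" "b \<in> D" unfolding D_def by (auto intro: generate.incl)
  obtain z d where zd: "z \<in> carrier W" "d \<in> D" "y = z \<otimes> d" "inversions (inv z) \<inter> D = {}"
    "\<And>m. m \<in> D \<Longrightarrow> len z \<le> len (z \<otimes> m)"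
    using minimal_coset_representative[OF D y] by metis
  have dC: "d \<in> carrier W" "inv d \<in> D"
    using zd D subgroup.mem_carrier subgroup.m_inv_closed by metis+
  have "a \<in> inversions (inv d)" "b \<in> inversions (inv d)"
    using inversions_coset[OF D zd(1,4,2)] abD less len_right y ab zd(3) by blast+
  show thesis
  proof (cases "odd_elt d")
    case False
    have "y \<otimes> inv d = z" using zd dC by (simp add: m_assoc)
    moreover have "z \<otimes> (d \<otimes> a) = y \<otimes> a" using zd dC ab by (simp add: m_assoc)
    then have "len z \<le> len (y \<otimes> a)"
      using zd(5)[of "d \<otimes> a"] subgroup.m_closed[OF D zd(2) abD(1)] by simp
    ultimately show thesis
      using that[of "inv d"] less dC False odd_elt_inv D_def by simp
  next
    case True
    obtain ws where ws: "ws \<in> lists (canonical D)" "pr ws = d" "length ws = word_length (canonical D) d"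
      using word_length_attained[OF canonical_subset(1), of d D] canonical_generates[of "{a, b}"] zd ab D_def
      by auto
    have "ws \<in> lists T" using ws canonical_mem by auto
    then have odd: "odd (length ws)" using odd_elt_word_prod[of ws] True ws(2) by simp
    then obtain v us where v: "ws = v # us" by (cases ws) auto
    have vt: "v \<in> canonical D" "v \<in> T" "v \<in> D" using v ws canonical_mem by auto
    have "us \<noteq> []"
    proof
      assume "us = []"
      then have "d = v" using ws v vt by simp
      then show False
        using \<open>a \<in> inversions (inv d)\<close> \<open>b \<in> inversions (inv d)\<close> inversions_canonical[OF vt(1)] vt abD ab
        by simp
    qed
    then have "len (z \<otimes> pr [v]) < len (z \<otimes> pr ([v] @ us))"
      using ws v by (intro len_coset_increase[OF D order_refl zd(1,4)]) auto
    then have "len (z \<otimes> v) < len y" using ws v zd vt by simp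
    moreover have "y \<otimes> (inv d \<otimes> v) = z \<otimes> v" using zd dC vt by (simp add: m_assoc)
    moreover have "inv d \<otimes> v \<in> D" using D dC vt subgroup.m_closed by metis
    moreover have "\<not> odd_elt (inv d \<otimes> v)" using True dC vt odd_elt_inv by (simp add: odd_elt_mult)
    ultimately show thesis using that D_def by simp
  qed
qed

text \<open>
  The sum of the lengths of the vertices after \<open>w\<close> on the path that starts at \<open>w\<close> and multiplies
  successively by the factors; it is the termination measure for removing peaks.
\<close>

primrec path_weight :: "'a \<Rightarrow> 'a list \<Rightarrow> nat" where
  "path_weight w [] = 0"
| "path_weight w (t # ts) = len (w \<otimes> t) + path_weight (w \<otimes> t) ts"

lemma path_weight_append:
  "w \<in> carrier W \<Longrightarrow> set us \<subseteq> carrier W \<Longrightarrow>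
    path_weight w (us @ vs) = path_weight w us + path_weight (w \<otimes> pr us) vs"
  by (induction us arbitrary: w) (auto simp: m_assoc)

definition ascending :: "'a list \<Rightarrow> bool" where
  "ascending ts \<longleftrightarrow> (\<forall>us t vs. ts = us @ t # vs \<longrightarrow> len (pr us) < len (pr us \<otimes> t))"

lemma generate_Un_cong:
  assumes "A \<subseteq> T" "X \<subseteq> T" "Y \<subseteq> T" "gen X = gen Y"
  shows "gen (A \<union> X) = gen (A \<union> Y)"
proof -
  have "X \<subseteq> gen (A \<union> Y)" "Y \<subseteq> gen (A \<union> X)"
    using assms(4) generate.incl[of _ X W] generate.incl[of _ Y W]
      mono_generate[of X "A \<union> X"] mono_generate[of Y "A \<union> Y"] by blast+
  moreover have "A \<subseteq> gen (A \<union> Y)" "A \<subseteq> gen (A \<union> X)" by (auto intro: generate.incl)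
  moreover have "A \<union> X \<subseteq> carrier W" "A \<union> Y \<subseteq> carrier W" using assms by auto
  ultimately show ?thesis by (intro generate_eqI) auto
qed

text \<open>
  Induction on the sum of the lengths of the partial products. At the first descent after an ascent,
  with different factors \<open>a\<close> and \<open>b\<close>, the pair is replaced by a pair \<open>c, c'\<close> with \<open>c c' = a b\<close>, where
  \<open>c = a e\<close> is chosen so that the intermediate partial product becomes shorter.
\<close>

lemma ascending_or_repetition:
  assumes "ts \<in> lists T"
  obtains ts' where "ts' \<in> lists T" "length ts' = length ts" "pr ts' = pr ts"
    "gen (set ts') = gen (set ts)" "ascending ts' \<or> (\<exists>us r vs. ts' = us @ r # r # vs)"
proof -
  have "\<exists>ts'\<in>lists T. length ts' = length ts \<and> pr ts' = pr ts \<and> gen (set ts') = gen (set ts) \<and>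
      (ascending ts' \<or> (\<exists>us r vs. ts' = us @ r # r # vs))" if "ts \<in> lists T" for ts
    using that
  proof (induction "path_weight \<one> ts" arbitrary: ts rule: less_induct)
    case less
    show ?case
    proof (cases "ascending ts \<or> (\<exists>us r vs. ts = us @ r # r # vs)")
      case False
      let ?P = "\<lambda>us. \<exists>t vs. ts = us @ t # vs \<and> \<not> len (pr us) < len (pr us \<otimes> t)"
      have "\<exists>us. ?P us" using False ascending_def by auto
      then obtain us where us: "?P us" "\<And>us'. ?P us' \<Longrightarrow> length us \<le> length us'"
        using ex_has_least_nat[of ?P _ length] by metis
      then obtain b vs where bvs: "ts = us @ b # vs" "\<not> len (pr us) < len (pr us \<otimes> b)" by blast
      have bT: "b \<in> T" using bvs less.prems by auto
      (* the first step from the identity always goes up *)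
      have "us \<noteq> []"
      proof
        assume "us = []"
        then have "len b = 0" using bvs bT by simp
        then show False
          using word_length_eq_0[OF simple_subset_reflections, of b] bT simple_generate reflection_neq_one
          by auto
      qed
      then obtain us' a where usa: "us = us' @ [a]" using rev_exhaust by blast
      have T: "us' \<in> lists T" "a \<in> T" "vs \<in> lists T" using less.prems bvs usa by auto
      have car: "set us' \<subseteq> carrier W" "pr us' \<in> carrier W" using T by (auto intro!: word_prod_closed)
      let ?w = "pr us'"
      let ?y = "?w \<otimes> a"
      have y: "pr us = ?y" "?y \<in> carrier W" using usa car T word_prod_append[of us' "[a]"] by auto
      have up: "len ?w < len ?y"
        using us(2)[of us'] usa bvs(1) by force
      have "a \<noteq> b" using False usa bvs by auto
      moreover have "len (?y \<otimes> a) < len ?y" using up car T by (simp add: m_assoc)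
      moreover have "len (?y \<otimes> b) < len ?y"
        using bvs(2) y bT len_right[of b ?y] len_right_increase[of b ?y] by auto
      ultimately obtain e where e: "e \<in> gen {a, b}" "\<not> odd_elt e" "len (?y \<otimes> e) < len ?y"
        using peak_descent[OF T(2) bT _ y(2)] by metis
      have eC: "e \<in> carrier W" using e generate_carrier[of "{a, b}"] T bT by auto
      have "a \<otimes> e \<in> gen {a, b}" using e by (auto intro: generate.eng generate.incl)
      moreover have "odd_elt (a \<otimes> e)" using e eC T by (simp add: odd_elt_mult)
      ultimately obtain c' where c': "hurwitz a b (a \<otimes> e) c'"
        using dihedral_odd[OF T(2) bT] by metis
      (* w c = y e, so the new partial product is shorter than the old one, y = w a *)
      define c where "c = a \<otimes> e"
      have c: "c \<in> T" "c' \<in> T" "c \<otimes> c' = a \<otimes> b" "gen {c, c'} = gen {a, b}"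
        using hurwitz_invariant[OF c' T(2) bT] c_def by auto
      let ?ts = "us' @ c # c' # vs"
      have ts: "ts = us' @ a # b # vs" using bvs usa by simp
      have "?w \<otimes> c = ?y \<otimes> e" using c_def car T eC by (simp add: m_assoc)
      moreover have "?w \<otimes> c \<otimes> c' = ?w \<otimes> a \<otimes> b" using c car T bT by (simp add: m_assoc)
      ultimately have "path_weight \<one> ?ts < path_weight \<one> ts"
        using e(3) car unfolding ts by (simp add: path_weight_append)
      moreover have "?ts \<in> lists T" using T c by auto
      ultimately obtain ts' where ts': "ts' \<in> lists T" "length ts' = length ?ts" "pr ts' = pr ?ts"
        "gen (set ts') = gen (set ?ts)" "ascending ts' \<or> (\<exists>us r vs. ts' = us @ r # r # vs)"
        using less.hyps[of ?ts] by blast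
      have vsC: "pr vs \<in> carrier W" "set vs \<subseteq> carrier W" using T by (auto intro!: word_prod_closed)
      have "c \<otimes> (c' \<otimes> pr vs) = a \<otimes> (b \<otimes> pr vs)" using c T bT vsC by (simp flip: m_assoc)
      then have "pr ?ts = pr ts"
        unfolding ts using car vsC c T bT by (simp add: word_prod_append)
      moreover have "gen ((set us' \<union> set vs) \<union> {c, c'}) = gen ((set us' \<union> set vs) \<union> {a, b})"
        using T c bT by (intro generate_Un_cong) auto
      then have "gen (set ?ts) = gen (set ts)" unfolding ts by (simp add: insert_commute Un_commute)
      moreover have "length ?ts = length ts" unfolding ts by simp
      ultimately show ?thesis using ts' by metis
    qed (use less.prems in blast)
  qed
  then show thesis using assms that by metis
qed

section \<open>Parabolic subgroups\<close>

text \<open>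
  The inversions are palindromes of a word in \<open>I\<close>, hence products of elements of \<open>I\<close>.
\<close>

lemma standard_inversions:
  assumes "I \<subseteq> S" "w \<in> gen I" shows "inversions w \<subseteq> gen I"
proof
  fix q assume q: "q \<in> inversions w"
  have IT: "I \<subseteq> T" using assms by auto
  then obtain ws where ws: "ws \<in> lists I" "pr ws = w" using generate_word assms by metis
  have "w \<in> carrier W" using generate_carrier[OF IT] assms by blast
  then have "q \<in> carrier W" using q unfolding inversions_def by simp
  then have "q \<in> set (palindromes ws)"
    using inversions_word[of ws q] ws q assms(1) by (metis count_notin even_zero lists_mono subsetD)
  moreover have "set ws \<subseteq> gen I" using ws by (auto intro: generate.incl)
  ultimately show "q \<in> gen I" using palindromes_subgroup generate_subgroup[OF IT] by blast
qed

lemma canonical_standard: assumes "I \<subseteq> S" shows "canonical (gen I) = I"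
  using assms by (intro canonical_eqI) (auto intro!: simple_canonical generate.incl)

text \<open>
  In an ascending factorization the last factor is an inversion of the inverse of the product, hence in
  \<open>W\<^sub>I\<close>; strip it and repeat.
\<close>

lemma ascending_standard:
  assumes I: "I \<subseteq> S" and "ts \<in> lists T" "ascending ts" "pr ts \<in> gen I"
  shows "set ts \<subseteq> gen I"
  using assms(2-4)
proof (induction ts rule: rev_induct)
  case (snoc t ts)
  have sub: "subgroup (gen I) W" using I by (intro generate_subgroup) auto
  have t: "t \<in> T" "ts \<in> lists T" "pr ts \<in> carrier W" "set ts \<subseteq> carrier W"
    using snoc.prems by (auto intro!: word_prod_closed)
  then have prod: "pr (ts @ [t]) = pr ts \<otimes> t" by (simp add: word_prod_append)
  let ?x = "pr (ts @ [t])"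
  have x: "?x \<otimes> t = pr ts" "?x \<in> carrier W" using prod t by (simp_all add: m_assoc)
  have "len (pr ts) < len (pr ts \<otimes> t)" using snoc.prems(2) by (auto simp: ascending_def)
  then have "t \<in> inversions (inv ?x)" using len_right[of t ?x] x t prod by simp
  moreover have "inv ?x \<in> gen I" using snoc.prems(3) sub subgroup.m_inv_closed by metis
  ultimately have tI: "t \<in> gen I" using standard_inversions[OF I] by blast
  then have "pr ts \<in> gen I" using x(1) snoc.prems(3) sub subgroup.m_closed by metis
  moreover have "ascending ts" using snoc.prems(2) unfolding ascending_def
    by (metis append.assoc append_Cons)
  ultimately show ?case using snoc.IH t tI by simp
qed simp

lemma parabolic_subgroup_is_subgroup:
  assumes "g \<in> carrier W" "I \<subseteq> S" shows "subgroup (parabolic W g I) W"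
proof -
  have "I \<subseteq> T" using assms by auto
  then show ?thesis
    using subgroup_conjugate[OF assms(1)] generate_subgroup by (simp add: parabolic_def conj_set_eq_image)
qed

lemma mem_parabolic_iff:
  assumes "g \<in> carrier W" "I \<subseteq> S" "x \<in> carrier W"
  shows "x \<in> parabolic W g I \<longleftrightarrow> conjugate (inv g) x \<in> gen I"
proof -
  have "I \<subseteq> T" using assms by auto
  then have "gen I \<subseteq> carrier W" by (rule generate_carrier)
  then have "conjugate (inv g) x \<in> gen I" if "x \<in> conjugate g ` gen I"
    using that assms(1) by auto
  moreover have "x = conjugate g (conjugate (inv g) x)" using assms by simp
  ultimately show ?thesis
    unfolding parabolic_def conj_set_eq_image by (metis imageI)
qed

text \<open>
  The dichotomy for an arbitrary parabolic subgroup, by conjugating into the standard one. As the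
  generated subgroup is preserved, the conclusion can be stated for the original factorization.
\<close>

lemma ascending_or_repetition_parabolic:
  assumes g: "g \<in> carrier W" and I: "I \<subseteq> S" and ts: "ts \<in> lists T" "pr ts \<in> parabolic W g I"
  shows "gen (set ts) \<subseteq> parabolic W g I \<or>
    (\<exists>us r vs. us @ r # r # vs \<in> lists T \<and> length (us @ r # r # vs) = length ts \<and>
      pr (us @ r # r # vs) = pr ts \<and> gen (set (us @ r # r # vs)) = gen (set ts))"
proof -
  let ?c = "conjugate (inv g)"
  have tsC: "set ts \<subseteq> carrier W" using ts by auto
  have "map ?c ts \<in> lists T" using g ts by auto
  then obtain qs where qs: "qs \<in> lists T" "length qs = length ts" "pr qs = pr (map ?c ts)"
    "gen (set qs) = gen (set (map ?c ts))" "ascending qs \<or> (\<exists>us r vs. qs = us @ r # r # vs)"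
    using ascending_or_repetition[of "map ?c ts"] by (metis length_map)
  have qsC: "set qs \<subseteq> carrier W" using qs by auto
  have prqs: "pr qs = ?c (pr ts)" using qs(3) word_prod_map_conjugate[of "inv g" ts] g tsC by simp
  have conj_gen: "conjugate g ` gen (set qs) = gen (set ts)"
  proof -
    have "conjugate g ` ?c ` set ts = set ts"
      using tsC g by (force simp: image_image)
    moreover have "?c ` set ts \<subseteq> carrier W" using g tsC by auto
    ultimately show ?thesis
      using qs(4) generate_conjugate[OF g] by (metis list.set_map)
  qed
  from qs(5) show ?thesis
  proof
    assume "ascending qs"
    moreover have "pr qs \<in> gen I" using prqs mem_parabolic_iff[OF g I] ts(2) tsC by simp
    ultimately have "set qs \<subseteq> gen I" using ascending_standard I qs(1) by blast
    moreover have "subgroup (gen I) W" using I by (intro generate_subgroup) auto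
    ultimately have "gen (set qs) \<subseteq> gen I" by (intro generate_subset_subgroup)
    then have "conjugate g ` gen (set qs) \<subseteq> parabolic W g I"
      unfolding parabolic_def conj_set_eq_image by blast
    then show ?thesis using conj_gen by simp
  next
    assume "\<exists>us r vs. qs = us @ r # r # vs"
    then obtain us r vs where q: "qs = us @ r # r # vs" by blast
    let ?qs = "map (conjugate g) qs"
    have "?qs \<in> lists T" using qs g by auto
    moreover have "pr ?qs = pr ts" using word_prod_map_conjugate[OF g qsC] prqs g tsC by simp
    moreover have "gen (set ?qs) = gen (set ts)" using conj_gen generate_conjugate[OF g qsC] by simp
    moreover have "length ?qs = length ts" using qs by simp
    ultimately have "\<exists>us r vs. ?qs = us @ r # r # vs \<and> ?qs \<in> lists T \<and> length ?qs = length ts \<and>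
        pr ?qs = pr ts \<and> gen (set ?qs) = gen (set ts)"
      using q by auto
    then show ?thesis by metis
  qed
qed

lemma word_prod_drop_repetition:
  assumes "us @ r # r # vs \<in> lists T" shows "pr (us @ r # r # vs) = pr (us @ vs)"
proof -
  have "set us \<subseteq> carrier W" "set vs \<subseteq> carrier W" "r \<in> T" using assms by auto
  then show ?thesis by (simp add: word_prod_append)
qed

text \<open>
  A reduced factorization cannot be changed into one with two equal adjacent factors, which could be
  cancelled. In particular the reflection length of an element is the same in every parabolic subgroup
  that contains it.
\<close>

lemma reduced_factorization_parabolic:
  assumes "g \<in> carrier W" "I \<subseteq> S" "ts \<in> lists T" "pr ts \<in> parabolic W g I"
    "length ts = word_length T (pr ts)"
  shows "gen (set ts) \<subseteq> parabolic W g I"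
proof -
  have False if "us @ r # r # vs \<in> lists T" "length (us @ r # r # vs) = length ts"
    "pr (us @ r # r # vs) = pr ts" for us r vs
  proof -
    have "word_length T (pr ts) \<le> length (us @ vs)"
      using that word_prod_drop_repetition[OF that(1)] by (intro word_length_le) auto
    then show False using that assms(5) by simp
  qed
  then show ?thesis using ascending_or_repetition_parabolic[OF assms(1-4)] by blast
qed

section \<open>Recognizing the simple reflections\<close>

text \<open>
  The local-to-global principle for canonical generators: the hypothesis concerns pairs, the conclusion
  all of the subgroup generated by \<open>X\<close>. As in the classical argument for positivity of roots, split
  \<open>d = v e\<close> with \<open>e\<close> in the dihedral group \<open>D\<close> generated by \<open>t\<close> and the last letter \<open>t'\<close> of a shortest
  word for \<open>d\<close>, taking \<open>v\<close> as short as possible. By induction neither \<open>t\<close> nor \<open>t'\<close> is an inversion of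
  \<open>v\<^sup>-\<^sup>1\<close>, so \<open>v\<close> is minimal in \<open>v D\<close> and the question becomes one about \<open>e\<close> in \<open>D\<close>.
\<close>

lemma pairwise_canonical_increase:
  assumes X: "X \<subseteq> T"
    and pair: "\<And>a b. a \<in> X \<Longrightarrow> b \<in> X \<Longrightarrow> a \<noteq> b \<Longrightarrow> a \<in> canonical (gen {a, b})"
    and "d \<in> gen X" "t \<in> X" "word_length X d \<le> word_length X (d \<otimes> t)"
  shows "t \<notin> inversions (inv d)"
  using assms(3-5)
proof (induction "word_length X d" arbitrary: d t rule: less_induct)
  case less
  have XC: "X \<subseteq> carrier W" using X by auto
  have genC: "gen X \<subseteq> carrier W" using X by (rule generate_carrier)
  obtain ws where ws: "ws \<in> lists X" "pr ws = d" "length ws = word_length X d"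
    using word_length_attained[OF X less.prems(1)] .
  show ?case
  proof (cases ws rule: rev_cases)
    case Nil
    then have "d = \<one>" using ws(2) by simp
    then show ?thesis by simp
  next
    case (snoc us t')
    have us: "us \<in> lists X" "t' \<in> X" "set us \<subseteq> carrier W" using ws snoc XC by auto
    have t: "t \<in> T" "t' \<in> T" using X us less.prems by auto
    have usC: "pr us \<in> carrier W" "pr us \<in> gen X"
      using us XC by (auto intro!: word_prod_in_generate)
    have d: "d = pr us \<otimes> t'" using ws(2) snoc us t by (simp add: word_prod_append)
    have dC: "d \<in> carrier W" using d usC t by simp
    have shorter: "word_length X (pr us) < word_length X d"
      using minimal_prefix(1)[OF X, of us "[t']"] ws snoc by simp
    have usd: "word_length X (pr us) + 1 = word_length X d"
      using minimal_prefix(1)[OF X, of us "[t']"] ws snoc by simp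
    have "t \<noteq> t'" using less.prems(3) shorter d usC t by (auto simp: m_assoc)
    define Y where "Y = {t, t'}"
    define D where "D = gen Y"
    have Y: "Y \<subseteq> X" "Y \<subseteq> T" "Y \<subseteq> D"
      using us less.prems t D_def by (auto simp: Y_def intro: generate.incl)
    have D: "subgroup D W" using D_def Y generate_subgroup by simp
    have DX: "D \<subseteq> gen X" unfolding D_def using Y(1) by (rule mono_generate)
    have YD: "Y \<subseteq> canonical D"
      using pair[of t t'] pair[of t' t] \<open>t \<noteq> t'\<close> us less.prems D_def
      by (auto simp: Y_def insert_commute)
    (* splittings of d along a coset of D that are additive in word length *)
    let ?Q = "\<lambda>v. v \<in> gen X \<and> (\<exists>e\<in>D. d = v \<otimes> e \<and> word_length X v + word_length Y e = word_length X d)"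
    have "word_length Y t' = 1" using word_length_generator Y by (simp add: Y_def)
    then have "?Q (pr us)" using usC usd d Y by (auto simp: Y_def)
    then obtain v where v: "?Q v" "\<And>u. ?Q u \<Longrightarrow> word_length X v \<le> word_length X u"
      using ex_has_least_nat[of ?Q "pr us" "word_length X"] by blast
    then obtain e where e: "e \<in> D" "d = v \<otimes> e" "word_length X v + word_length Y e = word_length X d"
      by blast
    have vC: "v \<in> gen X" "v \<in> carrier W" "e \<in> carrier W" "e \<in> gen Y"
      using v(1) genC e DX D_def by auto
    have vd: "word_length X v < word_length X d"
      using v(2)[OF \<open>?Q (pr us)\<close>] shorter by simp
    have Yv: "u \<notin> inversions (inv v)" if u: "u \<in> Y" for u
    proof -
      have uT: "u \<in> T" "u \<in> X" "u \<in> D" using u Y by auto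
      have vu: "v \<otimes> u \<in> gen X" using vC uT by (metis generate.eng generate.incl)
      have ue: "u \<otimes> e \<in> D" using uT e D subgroup.m_closed by metis
      have dd: "d = (v \<otimes> u) \<otimes> (u \<otimes> e)" using e vC uT by (simp add: m_assoc)
      have "word_length X v \<le> word_length X (v \<otimes> u)"
      proof (rule ccontr)
        assume less: "\<not> word_length X v \<le> word_length X (v \<otimes> u)"
        have "word_length Y (u \<otimes> e) \<le> 1 + word_length Y e"
          using word_length_mult[OF Y(2), of u e] word_length_generator[OF u Y(2)] u vC
          by (auto intro: generate.incl)
        moreover have "word_length X d \<le> word_length X (v \<otimes> u) + word_length X (u \<otimes> e)"
          using word_length_mult[OF X vu, of "u \<otimes> e"] ue DX dd by auto
        moreover have "word_length X (u \<otimes> e) \<le> word_length Y (u \<otimes> e)"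
          using word_length_antimono[OF Y(1) X] ue D_def by simp
        ultimately have "word_length X (v \<otimes> u) + word_length Y (u \<otimes> e) = word_length X d"
          using e(3) less by simp
        then have "?Q (v \<otimes> u)" using vu ue dd by blast
        then show False using v(2) less by simp
      qed
      then show ?thesis using less.hyps[OF vd vC(1) uT(2)] by simp
    qed
    have "inversions (inv v) \<inter> D = {}"
    proof -
      obtain z f where zf: "z \<in> carrier W" "f \<in> D" "v = z \<otimes> f" "inversions (inv z) \<inter> D = {}"
        using minimal_coset_representative[OF D vC(2)] by metis
      have f: "f \<in> carrier W" "inv f \<in> gen Y" "inv f \<in> carrier W"
        using zf D D_def subgroup.mem_carrier subgroup.m_inv_closed inv_closed by metis+
      obtain us where us: "us \<in> lists Y" "pr us = inv f" "length us = word_length Y (inv f)"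
        using word_length_attained[OF Y(2) f(2)] .
      have "us = []"
      proof (cases us)
        case (Cons u us')
        have u: "u \<in> Y" "u \<in> T" "u \<in> D" using Cons us Y by auto
        have "set us' \<subseteq> carrier W" using Cons us Y by auto
        then have "u \<otimes> inv f = pr us'" using us(2) Cons u by (simp flip: us(2))
        then have "word_length Y (u \<otimes> inv f) < word_length Y (inv f)"
          using word_length_le[of us' Y] us Cons by simp
        then have "u \<in> inversions (inv f)"
          using inversion_iff_word_length[OF D YD f(2), of u] u D_def by simp
        then show ?thesis
          using inversions_coset[OF D zf(1,4,2) u(3)] zf(3) Yv[OF u(1)] by simp
      qed simp
      then have "f = \<one>" using us f by (metis inv_inv inv_one word_prod_Nil)
      then show ?thesis using zf by simp
    qed
    note coset = inversions_coset[OF D vC(2) this e(1)]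
    show ?thesis
    proof
      assume "t \<in> inversions (inv d)"
      then have "t \<in> inversions (inv e)" using coset[of t] e(2) Y by (simp add: Y_def)
      moreover have ie: "inv e \<in> gen Y" using e(1) D D_def subgroup.m_inv_closed by metis
      ultimately have "word_length Y (t \<otimes> inv e) < word_length Y (inv e)"
        using word_length_inversion[OF D YD, of "inv e" t] Y by (simp add: Y_def)
      moreover have "t \<otimes> inv e = inv (e \<otimes> t)" using vC t by (simp add: inv_mult_group)
      moreover have et: "e \<otimes> t \<in> gen Y" using vC by (auto simp: Y_def intro: generate.eng generate.incl)
      ultimately have "word_length Y (e \<otimes> t) < word_length Y e"
        using word_length_inv[OF Y(2)] vC by simp
      moreover have "word_length X (e \<otimes> t) \<le> word_length Y (e \<otimes> t)"
        using word_length_antimono[OF Y(1) X et] .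
      moreover have "word_length X (d \<otimes> t) \<le> word_length X v + word_length X (e \<otimes> t)"
        using word_length_mult[OF X vC(1), of "e \<otimes> t"] et DX D_def e(2) vC t
        by (auto simp: m_assoc)
      ultimately show False using e(3) less.prems(3) by simp
    qed
  qed
qed

text \<open>
  By the previous lemma \<open>\<ell>\<close> increases along the last step of a shortest word in \<open>X\<close> for a simple
  reflection, which has length one; so the word has only one letter.
\<close>

lemma simple_subset_pairwise_canonical:
  assumes X: "X \<subseteq> T"
    and pair: "\<And>a b. a \<in> X \<Longrightarrow> b \<in> X \<Longrightarrow> a \<noteq> b \<Longrightarrow> a \<in> canonical (gen {a, b})"
    and gen: "gen X = carrier W"
  shows "S \<subseteq> X"
proof
  fix s assume s: "s \<in> S"
  obtain ws where ws: "ws \<in> lists X" "pr ws = s" "length ws = word_length X s"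
    using word_length_attained[OF X, of s] gen s by auto
  have XC: "X \<subseteq> carrier W" using X by auto
  show "s \<in> X"
  proof (cases ws rule: rev_cases)
    case Nil
    then show ?thesis using ws(2) reflection_neq_one[OF simple_reflection[OF s]] by simp
  next
    case (snoc us a)
    have us: "us \<in> lists X" "a \<in> X" "set us \<subseteq> carrier W" "a \<in> T" using ws snoc X XC by auto
    have d: "pr us \<in> gen X" "pr us \<in> carrier W" using us gen by auto
    have s': "s = pr us \<otimes> a" using ws(2) snoc us by (simp add: word_prod_append)
    have min: "length us = word_length X (pr us)"
      using minimal_prefix(1)[OF X, of us "[a]"] ws snoc by simp
    then have "a \<notin> inversions (inv (pr us))"
      using pairwise_canonical_increase[OF X pair d(1) us(2)] ws snoc s' by auto
    then have "len (pr us) < len s" using len_right_increase us d s' by simp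
    then have "len (pr us) = 0"
      using word_length_generator[OF s simple_subset_reflections] by simp
    then have "pr us = \<one>"
      using word_length_eq_0[OF simple_subset_reflections, of "pr us"] d simple_generate by simp
    then show ?thesis using s' us by simp
  qed
qed

lemma minimal_canonical_word_ascending:
  assumes M: "subgroup M W" and X: "X \<subseteq> canonical M"
    and ws: "ws \<in> lists X" "length ws = word_length X (pr ws)"
  shows "ascending ws"
  unfolding ascending_def
proof (intro allI impI)
  fix us t vs assume w: "ws = us @ t # vs"
  have XT: "X \<subseteq> T" using X canonical_subset by blast
  have "(us @ [t]) @ vs \<in> lists X" using ws w by simp
  then have "length (us @ [t]) = word_length X (pr (us @ [t]))"
    using minimal_prefix(1)[OF XT, of "us @ [t]" vs] ws w by simp
  then have "len (\<one> \<otimes> pr us) < len (\<one> \<otimes> pr (us @ [t]))"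
    using ws w by (intro len_coset_increase[OF M X]) auto
  moreover have "X \<subseteq> carrier W" using XT by auto
  then have "set us \<subseteq> carrier W" "t \<in> carrier W" using ws w by auto
  ultimately show "len (pr us) < len (pr us \<otimes> t)" by (simp add: word_prod_append)
qed

text \<open>
  The parts before and after the letter are removed one at a time: the right one directly, the left one
  after passing to inverses.
\<close>

lemma len_letter_less:
  assumes M: "subgroup M W" and X: "X \<subseteq> canonical M"
    and ws: "us @ q # vs \<in> lists X" "length (us @ q # vs) = word_length X (pr (us @ q # vs))"
    and ne: "us \<noteq> [] \<or> vs \<noteq> []"
  shows "len q < len (pr (us @ q # vs))"
proof -
  have XT: "X \<subseteq> T" using X canonical_subset by blast
  then have XC: "X \<subseteq> carrier W" by auto
  have car: "set us \<subseteq> carrier W" "set vs \<subseteq> carrier W" "q \<in> X" "q \<in> carrier W" "us \<in> lists X"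
    using ws XC by auto
  let ?u = "us @ [q]"
  have u: "?u \<in> lists X" "?u @ vs \<in> lists X" "pr ?u \<in> carrier W" "set ?u \<subseteq> carrier W"
    using ws car by auto
  have min: "length ?u = word_length X (pr ?u)"
    using minimal_prefix(1)[OF XT u(2)] ws by simp
  have right: "len (pr ?u) < len (pr (us @ q # vs))" if "vs \<noteq> []"
  proof -
    have "len (\<one> \<otimes> pr ?u) < len (\<one> \<otimes> pr (?u @ vs))"
      using ws that u by (intro len_coset_increase[OF M X]) auto
    then show ?thesis using u car by simp
  qed
  have left: "len q < len (pr ?u)" if "us \<noteq> []"
  proof -
    have ug: "pr ?u \<in> gen X" using word_prod_in_generate[of ?u X] u XC by auto
    have "?u \<in> lists T" using u XT by auto
    then have rev: "inv (pr ?u) = pr ([q] @ rev us)" using inv_word_prod[of ?u] by simp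
    have "length ([q] @ rev us) = word_length X (pr ([q] @ rev us))"
      using min rev word_length_inv[OF XT ug] by simp
    then have "len (\<one> \<otimes> pr [q]) < len (\<one> \<otimes> pr ([q] @ rev us))"
      using that car by (intro len_coset_increase[OF M X]) auto
    moreover have "pr ([q] @ rev us) \<in> carrier W" using rev u by (metis inv_closed)
    ultimately have "len q < len (inv (pr ?u))" using rev car by simp
    then show ?thesis using len_inv u by simp
  qed
  show ?thesis
  proof (cases "us = []")
    case True
    then show ?thesis using ne right car by simp
  next
    case False
    then show ?thesis using left right by (cases "vs = []") auto
  qed
qed

lemma word_prod_singleton: "p \<in> T \<Longrightarrow> ws \<in> lists {p} \<Longrightarrow> pr ws \<in> {\<one>, p}"
  by (induction ws rule: list.induct) auto

text \<open>
  A shortest word for \<open>t\<close> in the two canonical generators of the dihedral group is ascending, so all its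
  letters lie in \<open>W\<^sub>I\<close>. Since \<open>r \<notin> W\<^sub>I\<close>, only one of the two generators lies in \<open>W\<^sub>I\<close>, and the word
  can use no other letter: \<open>t\<close> is that generator.
\<close>

lemma dihedral_canonical_mixed:
  assumes I: "I \<subseteq> S" and t: "t \<in> T" "t \<in> gen I" and r: "r \<in> T" "r \<notin> gen I"
  obtains q where "canonical (gen {t, r}) = {t, q}" "q \<in> T" "q \<noteq> t"
proof -
  define D where "D = gen {t, r}"
  have D: "subgroup D W" using t r D_def generate_subgroup by simp
  have J: "subgroup (gen I) W" using I by (intro generate_subgroup) auto
  have tr: "t \<in> D" "r \<in> D" unfolding D_def by (auto intro: generate.incl)
  have gen: "gen (canonical D) = D" using canonical_generates[of "{t, r}"] t r D_def by simp
  have "t \<noteq> r" using t r by blast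
  then obtain p q where pq: "p \<noteq> q" "canonical D = {p, q}"
    using dihedral_canonical_pair[OF t(1) r(1)] D_def by metis
  have T: "p \<in> T" "q \<in> T" using canonical_mem(1)[of _ D] pq by auto
  have "\<not> canonical D \<subseteq> gen I"
    using generate_subset_subgroup[OF J, of "canonical D"] gen tr r by blast
  obtain ws where ws: "ws \<in> lists (canonical D)" "pr ws = t" "length ws = word_length (canonical D) t"
    using word_length_attained[OF canonical_subset(1), of t D] gen tr by auto
  have wsT: "ws \<in> lists T" using ws canonical_subset(1) by auto
  have "ascending ws"
    using minimal_canonical_word_ascending[OF D order_refl ws(1)] ws by simp
  then have wsI: "set ws \<subseteq> gen I" using ascending_standard[OF I wsT] ws t by simp
  have "ws \<noteq> []" using ws(2) reflection_neq_one[OF t(1)] by auto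
  have single: "t = a" if "canonical D = {a, b}" "b \<notin> gen I" for a b
  proof -
    have "ws \<in> lists {a}" using ws(1) wsI that by auto
    moreover have "a \<in> T" using that canonical_mem(1)[of a D] by simp
    ultimately show ?thesis using word_prod_singleton ws(2) reflection_neq_one t by blast
  qed
  show thesis
  proof (cases "q \<in> gen I")
    case True
    then have "p \<notin> gen I" using \<open>\<not> canonical D \<subseteq> gen I\<close> pq by auto
    then have "t = q" using single[of q p] pq by (simp add: insert_commute)
    then show thesis using that[of p] pq T D_def by (simp add: insert_commute)
  next
    case False
    then have "t = p" using single[of p q] pq by simp
    then show thesis using that[of q] pq T D_def by simp
  qed
qed

text \<open>
  The reflection \<open>r\<close> is replaced by a shortest reflection \<open>r'\<close> that also generates \<open>W\<close> together with
  \<open>A\<close>. For a canonical generator \<open>t\<close> of the subgroup \<open>M\<close> generated by \<open>A\<close>, the dihedral group of \<open>t\<close> and \<open>r'\<close>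
  has canonical generators \<open>t\<close> and some \<open>q\<close>. Then \<open>q\<close> could serve in place of \<open>r'\<close> and would be
  shorter unless \<open>q = r'\<close>. So the canonical generators of \<open>M\<close> and \<open>r'\<close> are pairwise canonical, and
  they contain \<open>S\<close>; as \<open>r' \<notin> W\<^sub>I\<close>, those of \<open>M\<close> contain \<open>I\<close>.
\<close>

lemma generate_eq_standard:
  assumes I: "I \<subseteq> S" "gen I \<noteq> carrier W" and A: "A \<subseteq> T" "A \<subseteq> gen I"
    and r: "r \<in> T" "gen (insert r A) = carrier W"
  shows "gen A = gen I"
proof -
  have J: "subgroup (gen I) W" using I(1) by (intro generate_subgroup) auto
  let ?Q = "\<lambda>r. r \<in> T \<and> gen (insert r A) = carrier W"
  obtain r' where r': "?Q r'" "\<And>q. ?Q q \<Longrightarrow> len r' \<le> len q"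
    using ex_has_least_nat[of ?Q r len] r by blast
  have r'I: "r' \<notin> gen I"
  proof
    assume "r' \<in> gen I"
    then have "gen (insert r' A) \<subseteq> gen I" using A by (intro generate_subset_subgroup[OF J]) auto
    then show False using r' I subgroup.subset[OF J] by auto
  qed
  define M where "M = gen A"
  have M: "subgroup M W" using M_def A generate_subgroup by simp
  have MI: "M \<subseteq> gen I" using M_def A generate_subset_subgroup[OF J] by simp
  define X where "X = insert r' (canonical M)"
  have XT: "X \<subseteq> T" using X_def r' canonical_subset by auto
  have genM: "gen (canonical M) = M" using canonical_generates A M_def by simp
  have AM: "A \<subseteq> M" unfolding M_def by (auto intro: generate.incl)
  have mixed: "canonical (gen {t, r'}) = {t, r'}" if t: "t \<in> canonical M" for t
  proof -
    have tT: "t \<in> T" "t \<in> M" "t \<in> gen I" using t canonical_mem MI by auto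
    obtain q where q: "canonical (gen {t, r'}) = {t, q}" "q \<in> T" "q \<noteq> t"
      using dihedral_canonical_mixed[OF I(1) tT(1,3)] r' r'I by metis
    define D where "D = gen {t, r'}"
    have D: "subgroup D W" using D_def tT r' generate_subgroup by simp
    have genD: "gen {t, q} = D" using canonical_generates[of "{t, r'}"] q D_def tT r' by simp
    have r'D: "r' \<in> D" unfolding D_def by (auto intro: generate.incl)
    have qA: "subgroup (gen (insert q A)) W" using q A by (intro generate_subgroup) auto
    have "M \<subseteq> gen (insert q A)" unfolding M_def by (intro mono_generate) auto
    then have "{t, q} \<subseteq> gen (insert q A)" using tT by (auto intro: generate.incl)
    then have "D \<subseteq> gen (insert q A)" using generate_subset_subgroup[OF qA] genD by metis
    then have "insert r' A \<subseteq> gen (insert q A)" using r'D by (auto intro: generate.incl)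
    then have "gen (insert q A) = carrier W"
      using generate_subset_subgroup[OF qA] r' subgroup.subset[OF qA] by blast
    then have le: "len r' \<le> len q" using r'(2) q by simp
    (* a shortest word for r' in t and q must use q, since r' lies outside W_I *)
    have "r' = q"
    proof (rule ccontr)
      assume ne: "r' \<noteq> q"
      have can: "{t, q} \<subseteq> canonical D" "{t, q} \<subseteq> T" using q D_def tT by auto
      obtain ws where ws: "ws \<in> lists {t, q}" "pr ws = r'" "length ws = word_length {t, q} r'"
        using word_length_attained[OF can(2), of r'] genD r'D by auto
      have "q \<in> set ws"
      proof (rule ccontr)
        assume "q \<notin> set ws"
        then have "ws \<in> lists {t}" using ws(1) by auto
        then have "r' \<in> {\<one>, t}" using word_prod_singleton[OF tT(1)] ws(2) by blast
        then show False using r' r'I tT reflection_neq_one by auto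
      qed
      then obtain us vs where uv: "ws = us @ q # vs" by (meson split_list)
      have "us \<noteq> [] \<or> vs \<noteq> []" using uv ws(2) ne q by auto
      then have "len q < len r'"
        using len_letter_less[OF D can(1), of us q vs] uv ws by simp
      then show False using le by simp
    qed
    then show ?thesis using q by simp
  qed
  have "a \<in> canonical (gen {a, b})" if ab: "a \<in> X" "b \<in> X" "a \<noteq> b" for a b
  proof (cases "a = r' \<or> b = r'")
    case True
    then show ?thesis using mixed[of a] mixed[of b] ab X_def by (auto simp: insert_commute)
  next
    case False
    then have c: "a \<in> canonical M" "b \<in> M" using ab X_def canonical_subset by auto
    moreover have "gen {a, b} \<subseteq> M"
      using c canonical_mem by (intro generate_subset_subgroup[OF M]) auto
    moreover have "a \<in> gen {a, b}" by (rule generate.incl) simp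
    ultimately show ?thesis using canonical_antimono[of a M "gen {a, b}"] by simp
  qed
  moreover have "gen X = carrier W"
  proof -
    have XW: "subgroup (gen X) W" using XT by (rule generate_subgroup)
    have "M \<subseteq> gen X" using genM X_def mono_generate[of "canonical M" X] by auto
    then have "insert r' A \<subseteq> gen X" using AM X_def by (auto intro: generate.incl)
    then show ?thesis using generate_subset_subgroup[OF XW] r' subgroup.subset[OF XW] by blast
  qed
  ultimately have "S \<subseteq> X" using simple_subset_pairwise_canonical[OF XT] by blast
  moreover have "i \<noteq> r'" if "i \<in> I" for i using that r'I by (auto intro: generate.incl)
  ultimately have "I \<subseteq> M" using I(1) X_def canonical_mem(2) by blast
  then show ?thesis using MI M_def generate_subset_subgroup[OF M] by auto
qed

section \<open>Quasi-Coxeter elements of parabolic subgroups\<close>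

lemma generate_standard_proper:
  assumes "I \<subseteq> S" shows "gen I = carrier W \<longleftrightarrow> I = S"
  using canonical_standard[OF assms] canonical_standard[OF subset_refl] simple_generate by metis

lemma parabolic_proper:
  assumes "g \<in> carrier W" "I \<subseteq> S"
  shows "parabolic W g I = carrier W \<longleftrightarrow> I = S"
proof -
  have C: "conjugate g ` carrier W = carrier W" if "g \<in> carrier W" for g
    using conjugate_subgroup_self[OF subgroup_self that] .
  have "I \<subseteq> T" using assms by auto
  then have "gen I \<subseteq> carrier W" by (rule generate_carrier)
  then have "conjugate g ` gen I = carrier W \<longleftrightarrow> gen I = carrier W"
    using C[OF assms(1)] inj_on_image_eq_iff[OF inj_on_conjugate[OF assms(1)], of "gen I" "carrier W"]
    by auto
  then show ?thesis
    using generate_standard_proper[OF assms(2)] by (simp add: parabolic_def conj_set_eq_image)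
qed

lemma generate_eq_parabolic:
  assumes g: "g \<in> carrier W" and I: "I \<subseteq> S" "I \<noteq> S"
    and A: "A \<subseteq> T" "A \<subseteq> parabolic W g I" and r: "r \<in> T" "gen (insert r A) = carrier W"
  shows "gen A = parabolic W g I"
proof -
  let ?c = "conjugate (inv g)"
  have AC: "A \<subseteq> carrier W" "insert r A \<subseteq> carrier W" using A r by auto
  have "gen (insert (?c r) (?c ` A)) = ?c ` carrier W"
    using generate_conjugate[of "inv g" "insert r A"] g AC r by simp
  also have "\<dots> = carrier W" using conjugate_subgroup_self[OF subgroup_self] g by simp
  finally have "gen (insert (?c r) (?c ` A)) = carrier W" .
  moreover have "gen I \<noteq> carrier W" using generate_standard_proper I by blast
  moreover have "?c ` A \<subseteq> gen I"
  proof (rule image_subsetI)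
    fix a assume "a \<in> A"
    then show "?c a \<in> gen I" using mem_parabolic_iff[OF g I(1), of a] A AC by auto
  qed
  moreover have "?c ` A \<subseteq> T" "?c r \<in> T" using A(1) g r by auto
  ultimately have "gen (?c ` A) = gen I" using generate_eq_standard[OF I(1)] by blast
  then have "conjugate g ` ?c ` gen A = parabolic W g I"
    using generate_conjugate[of "inv g" A] g AC by (simp add: parabolic_def conj_set_eq_image)
  moreover have "conjugate g ` ?c ` gen A = gen A"
    using g generate_carrier[OF A(1)] by (force simp: image_image)
  ultimately show ?thesis by simp
qed

text \<open>
  The Coxeter-theoretic reflections of \<open>P\<close> are exactly the reflections of \<open>W\<close> that lie in \<open>P\<close>, because
  each reflection in \<open>W\<^sub>I\<close> is conjugate within \<open>W\<^sub>I\<close> to a canonical generator, and these form \<open>I\<close>.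
\<close>

lemma parabolic_reflections:
  assumes g: "g \<in> carrier W" and I: "I \<subseteq> S"
  shows "reflections (W\<lparr>carrier := parabolic W g I\<rparr>) (conj_set W g I) = T \<inter> parabolic W g I"
    (is "?L = T \<inter> ?P")
proof -
  have P: "subgroup ?P W" using parabolic_subgroup_is_subgroup[OF g I] .
  have IT: "I \<subseteq> T" using I by auto
  have gIP: "conjugate g i \<in> ?P" if "i \<in> I" for i
    using that unfolding parabolic_def conj_set_eq_image by (auto intro: generate.incl)
  have L: "?L = (\<Union>w\<in>?P. conjugate w ` conjugate g ` I)"
  proof -
    have "conj_set (W\<lparr>carrier := ?P\<rparr>) w A = conjugate w ` A" if "w \<in> ?P" for w A
      unfolding conj_set_def conjugate_def m_inv_consistent[OF P that] by simp
    moreover have "?L = (\<Union>w\<in>?P. conj_set (W\<lparr>carrier := ?P\<rparr>) w (conj_set W g I))"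
      by (simp add: reflections_def)
    ultimately show ?thesis unfolding conj_set_eq_image by (metis (no_types, lifting) SUP_cong)
  qed
  show ?thesis
  proof
    show "?L \<subseteq> T \<inter> ?P"
    proof
      fix t assume "t \<in> ?L"
      then obtain w i where w: "w \<in> ?P" "i \<in> I" "t = conjugate w (conjugate g i)"
        unfolding L by blast
      then have "w \<in> carrier W" "i \<in> T" using subgroup.subset[OF P] IT by auto
      then show "t \<in> T \<inter> ?P" using w g gIP subgroup_conjugate_closed[OF P] by simp
    qed
    show "T \<inter> ?P \<subseteq> ?L"
    proof
      fix t assume t: "t \<in> T \<inter> ?P"
      let ?t = "conjugate (inv g) t"
      have "?t \<in> T" "?t \<in> gen I" using t mem_parabolic_iff[OF g I, of t] g by auto
      then obtain d v where dv: "d \<in> gen I" "v \<in> I" "?t = conjugate d v"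
        using reflection_conjugate_canonical[OF generate_subgroup[OF IT]] canonical_standard[OF I]
        by metis
      have c: "d \<in> carrier W" "v \<in> carrier W" using dv generate_carrier[OF IT] IT by auto
      have "t = conjugate g (conjugate d v)" using dv(3) t g by (metis IntD1 conjugate_inv_cancel(1) reflection_carrier)
      also have "\<dots> = conjugate (conjugate g d) (conjugate g v)"
        using c g by (simp add: conjugate_def m_assoc inv_mult_group)
      finally have "t \<in> conjugate (conjugate g d) ` conjugate g ` I" using dv by blast
      moreover have "conjugate g d \<in> ?P"
        using dv unfolding parabolic_def conj_set_eq_image by blast
      ultimately show "t \<in> ?L" unfolding L by blast
    qed
  qed
qed

lemma quasi_coxeter_iff:
  "quasi_coxeter W S w \<longleftrightarrow>
    (\<exists>ts\<in>lists T. pr ts = w \<and> length ts = word_length T w \<and> length ts = card S \<and>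
      gen (set ts) = carrier W)"
proof -
  have "pr ts \<in> carrier W" if "ts \<in> lists T" for ts
    using that by (intro word_prod_closed) auto
  then show ?thesis
    unfolding quasi_coxeter_def reduced_reflection_factorization_def reflection_length_eq by blast
qed

lemma quasi_coxeter_parabolic_iff:
  assumes g: "g \<in> carrier W" and I: "I \<subseteq> S"
  defines "P \<equiv> parabolic W g I"
  shows "quasi_coxeter (W\<lparr>carrier := P\<rparr>) (conj_set W g I) x \<longleftrightarrow>
    (\<exists>ts\<in>lists (T \<inter> P). pr ts = x \<and> length ts = word_length (T \<inter> P) x \<and> length ts = card I \<and>
      gen (set ts) = P)"
proof -
  have P: "subgroup P W" using parabolic_subgroup_is_subgroup[OF g I] P_def by simp
  have refl: "reflections (W\<lparr>carrier := P\<rparr>) (conj_set W g I) = T \<inter> P"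
    using parabolic_reflections[OF g I] P_def by simp
  have prod: "word_prod (W\<lparr>carrier := P\<rparr>) ts = pr ts" for ts
    by (simp add: word_prod_def)
  have len: "reflection_length (W\<lparr>carrier := P\<rparr>) (conj_set W g I) y = word_length (T \<inter> P) y" for y
    by (simp add: reflection_length_def word_length_def refl prod)
  have "I \<subseteq> carrier W" using I by auto
  then have card: "card (conj_set W g I) = card I"
    unfolding conj_set_eq_image by (intro card_image inj_on_subset[OF inj_on_conjugate[OF g]])
  have gen: "generate (W\<lparr>carrier := P\<rparr>) (set ts) = gen (set ts)" if "ts \<in> lists (T \<inter> P)" for ts
    using that by (intro generate_consistent[OF _ P]) auto
  have closed: "pr ts \<in> P" if "ts \<in> lists (T \<inter> P)" for ts
    using that by (induction ts rule: list.induct)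
      (auto intro: subgroup.one_closed[OF P] subgroup.m_closed[OF P])
  have carrier: "carrier (W\<lparr>carrier := P\<rparr>) = P" by simp
  show ?thesis
    unfolding quasi_coxeter_def reduced_reflection_factorization_def refl prod len card carrier
    using gen closed by metis
qed

text \<open>
  Any parabolic subgroup containing the product contains the factors of the reduced factorization, hence
  the subgroup that they generate.
\<close>

lemma parabolic_closure_generated:
  assumes "g \<in> carrier W" "I \<subseteq> S" "ts \<in> lists T" "length ts = word_length T (pr ts)"
    and "gen (set ts) = parabolic W g I"
  shows "parabolic_closure W S (pr ts) = parabolic W g I"
proof -
  have tsC: "set ts \<subseteq> carrier W" using assms(3) by auto
  have "pr ts \<in> parabolic W g I"
    using word_prod_in_generate[OF order_refl tsC] assms(5) by simp
  moreover have "parabolic W g I \<subseteq> P" if P: "parabolic_subgroup W S P" "pr ts \<in> P" for P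
    using reduced_factorization_parabolic[of _ _ ts] assms P unfolding parabolic_subgroup_def by metis
  moreover have "parabolic_subgroup W S (parabolic W g I)"
    unfolding parabolic_subgroup_def using assms(1,2) by blast
  ultimately show ?thesis
    unfolding parabolic_closure_def by blast
qed

lemma card_eq_of_parabolic_eq:
  assumes "g \<in> carrier W" "I \<subseteq> S" "h \<in> carrier W" "J \<subseteq> S" "parabolic W g I = parabolic W h J"
  shows "card I = card J"
proof -
  have "card (canonical (parabolic W g I)) = card I" if "g \<in> carrier W" "I \<subseteq> S" for g I
  proof -
    have "subgroup (gen I) W" using that by (intro generate_subgroup) auto
    then show ?thesis
      using card_canonical_conjugate that canonical_standard
      by (simp add: parabolic_def conj_set_eq_image)
  qed
  then show ?thesis using assms by metis
qed

lemma parabolic_rank_eq: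
  assumes "g \<in> carrier W" "I \<subseteq> S" shows "parabolic_rank W S (parabolic W g I) = card I"
  unfolding parabolic_rank_def
  by (rule the_equality) (use assms card_eq_of_parabolic_eq in blast)+

text \<open>
  By parity the reflection length changes by one. If it went down, appending \<open>r\<close> to a
  reduced factorization of \<open>x r\<close> would give a reduced factorization of \<open>x\<close>, forcing \<open>r\<close> into the
  parabolic subgroup.
\<close>

lemma reflection_length_extend:
  assumes g: "g \<in> carrier W" and I: "I \<subseteq> S" and x: "x \<in> parabolic W g I"
    and r: "r \<in> T" "r \<notin> parabolic W g I"
  shows "word_length T (x \<otimes> r) = word_length T x + 1"
proof -
  have xC: "x \<in> carrier W"
    using x subgroup.mem_carrier[OF parabolic_subgroup_is_subgroup[OF g I]] by blast
  have le: "word_length T (x \<otimes> r) \<le> word_length T x + 1"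
    using word_length_mult[OF order_refl, of x r] word_length_generator[OF r(1)] xC r
    by (simp add: generate_reflections)
  obtain qs where qs: "qs \<in> lists T" "pr qs = x \<otimes> r" "length qs = word_length T (x \<otimes> r)"
    using word_length_attained[OF order_refl, of "x \<otimes> r"] generate_reflections xC r by auto
  obtain ps where ps: "ps \<in> lists T" "pr ps = x" "length ps = word_length T x"
    using word_length_attained[OF order_refl, of x] generate_reflections xC by auto
  have parity: "odd (length qs) \<longleftrightarrow> even (length ps)"
    using odd_elt_word_prod[OF qs(1)] odd_elt_word_prod[OF ps(1)] qs ps xC r by (simp add: odd_elt_mult)
  have qsr: "pr (qs @ [r]) = x" "qs @ [r] \<in> lists T"
    using qs r xC lists_reflections_carrier[OF qs(1)] by (auto simp: word_prod_append m_assoc)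
  have ge: "word_length T x \<le> length qs + 1" using word_length_le[OF qsr(2,1)] by simp
  have "\<not> word_length T x = length qs + 1"
  proof
    assume "word_length T x = length qs + 1"
    then have "gen (set (qs @ [r])) \<subseteq> parabolic W g I"
      using qsr x by (intro reduced_factorization_parabolic[OF g I]) auto
    moreover have "r \<in> gen (set (qs @ [r]))" by (rule generate.incl) simp
    ultimately show False using r by blast
  qed
  then show ?thesis using le ge parity qs(3) ps(3) by presburger
qed

text \<open>
  The element \<open>w\<close> is \<open>x r\<close> with \<open>r = g s g\<^sup>-\<^sup>1\<close>, where \<open>s\<close> is the simple reflection missing from \<open>I\<close>.
\<close>

lemma quasi_coxeter_extension:
  assumes g: "g \<in> carrier W" and I: "I \<subseteq> S" "parabolic W g I \<noteq> carrier W" and fin: "finite S"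
    and qc: "quasi_coxeter (W\<lparr>carrier := parabolic W g I\<rparr>) (conj_set W g I) x"
    and rl: "reflection_length W S x + 1 = card S"
  shows "parabolic_closure W S x = parabolic W g I" "card I + 1 = card S"
    "\<exists>w. quasi_coxeter W S w \<and> absolute_le W S x w"
proof -
  let ?P = "parabolic W g I"
  have P: "subgroup ?P W" using parabolic_subgroup_is_subgroup[OF g I(1)] .
  have "I \<subset> S" using parabolic_proper[OF g I(1)] I by blast
  then have "card I < card S" using fin psubset_card_mono by blast
  obtain ts where ts: "ts \<in> lists (T \<inter> ?P)" "pr ts = x" "length ts = card I" "gen (set ts) = ?P"
    using qc quasi_coxeter_parabolic_iff[OF g I(1)] by blast
  have tsT: "ts \<in> lists T" "set ts \<subseteq> carrier W" using ts by auto
  have "word_length T x \<le> card I" using word_length_le[OF tsT(1)] ts by metis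
  then show cI: "card I + 1 = card S"
    using rl \<open>card I < card S\<close> by (simp add: reflection_length_eq)
  then have red: "length ts = word_length T (pr ts)"
    using rl ts by (simp add: reflection_length_eq)
  show "parabolic_closure W S x = ?P"
    using parabolic_closure_generated[OF g I(1) tsT(1) red ts(4)] ts(2) by simp
  obtain s where s: "s \<in> S" "I \<subseteq> S - {s}" using \<open>I \<subset> S\<close> by blast
  have "card I = card (S - {s})" using cI s fin by simp
  then have Ss: "S = insert s I" using s fin card_subset_eq[of "S - {s}" I] by auto
  define r where "r = conjugate g s"
  have r: "r \<in> T" using r_def g s by simp
  have genW: "gen (insert r (set ts)) = carrier W"
  proof -
    have "insert r (set ts) \<subseteq> T" using r tsT by auto
    then have sub: "subgroup (gen (insert r (set ts))) W" by (rule generate_subgroup)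
    have "gen (set ts) \<subseteq> gen (insert r (set ts))" by (intro mono_generate) auto
    moreover have "conjugate g ` I \<subseteq> ?P"
      unfolding parabolic_def conj_set_eq_image by (auto intro: generate.incl)
    ultimately have "conjugate g ` S \<subseteq> gen (insert r (set ts))"
      using ts(4) unfolding Ss r_def by (auto intro: generate.incl)
    then have "gen (conjugate g ` S) \<subseteq> gen (insert r (set ts))"
      by (rule generate_subset_subgroup[OF sub])
    moreover have "gen (conjugate g ` S) = carrier W"
      using generate_conjugate[OF g simple_closed] simple_generate conjugate_subgroup_self[OF subgroup_self g]
      by simp
    ultimately show ?thesis using subgroup.subset[OF sub] by blast
  qed
  have rP: "r \<notin> ?P"
  proof
    assume "r \<in> ?P"
    then have "insert r (set ts) \<subseteq> ?P" using ts by auto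
    then have "carrier W \<subseteq> ?P" using generate_subset_subgroup[OF P] genW by metis
    then show False using I subgroup.subset[OF P] by blast
  qed
  have xP: "x \<in> ?P" using word_prod_in_generate[OF order_refl tsT(2)] ts by simp
  have xC: "x \<in> carrier W" using xP subgroup.mem_carrier[OF P] by blast
  let ?w = "x \<otimes> r"
  have wl: "word_length T ?w = word_length T x + 1"
    using reflection_length_extend[OF g I(1) xP r rP] .
  have "quasi_coxeter W S ?w"
    unfolding quasi_coxeter_iff
  proof (intro bexI conjI)
    show "pr (ts @ [r]) = ?w" using ts tsT r by (simp add: word_prod_append)
    show "length (ts @ [r]) = word_length T ?w" using red ts wl by simp
    show "length (ts @ [r]) = card S" using ts cI by simp
    show "gen (set (ts @ [r])) = carrier W" using genW by simp
    show "ts @ [r] \<in> lists T" using tsT r by simp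
  qed
  moreover have "absolute_le W S x ?w"
    using xC r wl word_length_generator[OF r order_refl]
    by (simp add: absolute_le_def reflection_length_eq)
  ultimately show "\<exists>w. quasi_coxeter W S w \<and> absolute_le W S x w" by blast
qed

text \<open>
  The factors \<open>t\<^sub>1, \<dots>, t\<^sub>n, t\<close> of \<open>x = w t\<close> generate \<open>W\<close> while \<open>x\<close> lies in a proper parabolic subgroup
  \<open>P\<close> of rank \<open>n - 1\<close>. So they can be rearranged to contain a cancelling pair \<open>r, r\<close>, and the other
  \<open>n - 1\<close> factors generate \<open>P\<close>.
\<close>

lemma proper_parabolic_quasi_coxeterI:
  assumes fin: "finite S" and w: "quasi_coxeter W S w" "absolute_le W S x w"
    and cl: "parabolic_closure W S x \<noteq> carrier W"
    and rl: "reflection_length W S x + 1 = card S"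
  shows "proper_parabolic_quasi_coxeter W S x"
proof -
  have xC: "x \<in> carrier W" "w \<in> carrier W"
    and add: "word_length T x + word_length T (inv x \<otimes> w) = word_length T w"
    using w(2) by (auto simp: absolute_le_def reflection_length_eq)
  obtain ts where ts: "ts \<in> lists T" "pr ts = w" "length ts = word_length T w" "length ts = card S"
    "gen (set ts) = carrier W"
    using w(1) quasi_coxeter_iff by blast
  have "word_length T (inv x \<otimes> w) = 1" using add ts rl by (simp add: reflection_length_eq)
  moreover obtain vs where vs: "vs \<in> lists T" "pr vs = inv x \<otimes> w" "length vs = word_length T (inv x \<otimes> w)"
    using word_length_attained[OF order_refl, of "inv x \<otimes> w"] generate_reflections xC by auto
  ultimately obtain t where t: "vs = [t]" "t \<in> T" by (cases vs) auto
  have "inv x \<otimes> w = t" using vs t by simp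
  then have "x \<otimes> t = w" using xC by auto
  then have wt: "w \<otimes> t = x" using xC t by (auto simp: m_assoc)
  have "\<exists>P. parabolic_subgroup W S P \<and> x \<in> P \<and> P \<noteq> carrier W"
  proof (rule ccontr)
    assume all: "\<not> ?thesis"
    have "parabolic W \<one> S = carrier W" using parabolic_proper[OF one_closed subset_refl] by simp
    then have "parabolic_subgroup W S (carrier W)" unfolding parabolic_subgroup_def by blast
    then have "{P. parabolic_subgroup W S P \<and> x \<in> P} = {carrier W}" using all xC by blast
    then show False using cl by (simp add: parabolic_closure_def)
  qed
  then obtain g J where gJ: "g \<in> carrier W" "J \<subseteq> S" "x \<in> parabolic W g J" "parabolic W g J \<noteq> carrier W"
    unfolding parabolic_subgroup_def by blast
  then have "J \<noteq> S" using parabolic_proper by blast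
  then obtain s where s: "s \<in> S" "J \<subseteq> S - {s}" using gJ(2) by blast
  (* a proper parabolic subgroup is enlarged to one of rank n - 1, the reflection length of x *)
  define I where "I = S - {s}"
  have I: "I \<subseteq> S" "I \<noteq> S" "card I + 1 = card S" using s fin card_gt_0_iff[of S] by (auto simp: I_def)
  define P where "P = parabolic W g I"
  have P: "subgroup P W" using parabolic_subgroup_is_subgroup[OF gJ(1) I(1)] P_def by simp
  have "P \<noteq> carrier W" using parabolic_proper[OF gJ(1) I(1)] I P_def by simp
  have xP: "x \<in> P"
    using gJ(3) mono_generate[of J I] s unfolding P_def I_def parabolic_def conj_set_eq_image by blast
  have "set ts \<subseteq> carrier W" using ts by auto
  then have tst: "pr (ts @ [t]) = x" "ts @ [t] \<in> lists T"
    using ts t wt by (auto simp: word_prod_append)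
  have "insert t (set ts) \<subseteq> T" using ts t by auto
  then have gent: "gen (set (ts @ [t])) = carrier W"
    using mono_generate[of "set ts" "set (ts @ [t])"] ts(5) generate_carrier[of "set (ts @ [t])"] by auto
  have "\<not> gen (set (ts @ [t])) \<subseteq> P"
    using gent \<open>P \<noteq> carrier W\<close> subgroup.subset[OF P] by blast
  then obtain us r vs where urv: "us @ r # r # vs \<in> lists T" "length (us @ r # r # vs) = length (ts @ [t])"
    "pr (us @ r # r # vs) = pr (ts @ [t])" "gen (set (us @ r # r # vs)) = gen (set (ts @ [t]))"
    using ascending_or_repetition_parabolic[OF gJ(1) I(1) tst(2)] tst(1) xP P_def by metis
  let ?qs = "us @ vs"
  have qs: "?qs \<in> lists T" "pr ?qs = x" "length ?qs = card I"
    using urv word_prod_drop_repetition[OF urv(1)] tst ts I by auto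
  then have red: "length ?qs = word_length T (pr ?qs)"
    using I rl by (simp add: reflection_length_eq)
  have "gen (set ?qs) \<subseteq> P"
    using reduced_factorization_parabolic[OF gJ(1) I(1) qs(1) _ red] qs(2) xP P_def by simp
  moreover have "set ?qs \<subseteq> gen (set ?qs)" by (auto intro: generate.incl)
  ultimately have qsP: "set ?qs \<subseteq> P" by blast
  have "gen (insert r (set ?qs)) = carrier W" using urv(4) gent by simp
  then have gen: "gen (set ?qs) = P"
    using generate_eq_parabolic[OF gJ(1) I(1,2), of "set ?qs" r] qs(1) qsP urv(1) P_def by auto
  have qsTP: "?qs \<in> lists (T \<inter> P)" using qs qsP by auto
  have "word_length T x \<le> word_length (T \<inter> P) x"
  proof -
    have "x \<in> gen (T \<inter> P)"
      using qsTP unfolding qs(2)[symmetric] by (intro word_prod_in_generate) auto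
    then show ?thesis by (intro word_length_antimono) auto
  qed
  moreover have "word_length (T \<inter> P) x \<le> length ?qs" using word_length_le[OF qsTP qs(2)] .
  ultimately have "length ?qs = word_length (T \<inter> P) x" using red qs(2) by simp
  then have "quasi_coxeter (W\<lparr>carrier := P\<rparr>) (conj_set W g I) x"
    using qsTP qs(2,3) gen unfolding P_def quasi_coxeter_parabolic_iff[OF gJ(1) I(1)] by blast
  then show ?thesis
    unfolding proper_parabolic_quasi_coxeter_def
    using gJ(1) I(1) \<open>P \<noteq> carrier W\<close> P_def by blast
qed

end

theorem theorem1p3:
  fixes W :: "('a, 'b) monoid_scheme" and S :: "'a set" and n :: nat and x :: 'a
  assumes "coxeter_system W S"
    and "finite S" and "card S = n"
    and "x \<in> carrier W"
    and "int (reflection_length W S x) = int n - 1"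
  shows "(proper_parabolic_quasi_coxeter W S x \<longleftrightarrow>
      (\<exists>w. quasi_coxeter W S w \<and> absolute_le W S x w \<and> parabolic_closure W S x \<noteq> carrier W)) \<and>
    (proper_parabolic_quasi_coxeter W S x \<longrightarrow>
      parabolic_subgroup W S (parabolic_closure W S x) \<and>
      int (parabolic_rank W S (parabolic_closure W S x)) = int n - 1)"
proof -
  interpret coxeter_system W S by fact
  have rl: "reflection_length W S x + 1 = card S" using assms(3,5) by simp
  have "(\<exists>w. quasi_coxeter W S w \<and> absolute_le W S x w \<and> parabolic_closure W S x \<noteq> carrier W) \<and>
      parabolic_subgroup W S (parabolic_closure W S x) \<and>
      int (parabolic_rank W S (parabolic_closure W S x)) = int n - 1"
    if qc: "proper_parabolic_quasi_coxeter W S x"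
  proof -
    obtain g I where gI: "g \<in> carrier W" "I \<subseteq> S" "parabolic W g I \<noteq> carrier W"
      "quasi_coxeter (W\<lparr>carrier := parabolic W g I\<rparr>) (conj_set W g I) x"
      using qc unfolding proper_parabolic_quasi_coxeter_def by meson
    note ext = quasi_coxeter_extension[OF gI(1-3) assms(2) gI(4) rl]
    have "parabolic_subgroup W S (parabolic W g I)"
      unfolding parabolic_subgroup_def using gI(1,2) by blast
    moreover have "int (card I) = int n - 1" using ext(2) assms(3) by simp
    ultimately show ?thesis
      unfolding ext(1) parabolic_rank_eq[OF gI(1,2)] using ext(3) gI(3) by blast
  qed
  then show ?thesis using proper_parabolic_quasi_coxeterI[OF assms(2) _ _ _ rl] by blast
qed

end
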